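(* Let $\Omega_T=\Omega\times(-T,0]$ be a bounded cylinder in $\mathbb R^{n+1}$. For $i=1,2$ and constants $C^1>c^1>0$, let $g_i\in C(\partial_p\Omega_T;\mathbb R_+)$ with $c^1<g_i<C^1$ and $f_i\in L^\infty(\Omega_T;\mathbb R_+)$, and assume that $h_i\in\mathcal H$ and $k_i\in\mathcal K$. For $i=1,2$ let $\mathcal F^i(\Omega_T)$ be function classes such that the operator $\mathcal L_i$ satisfies the parabolic Solvability, Comparison and Convergence properties (defined in the context) on $\mathcal F^i(\Omega_T)$. Then there exists a solution $(u,v)\in\mathcal F^1(\Omega_T)\times\mathcal F^2(\Omega_T)$ of the system $$\begin{cases}\mathcal L_1u-\partial_tu=f_1k_1(v)h_1(u)&\text{in }\Omega_T\cap\{u>0\},\\ \mathcal L_2v-\partial_tv=f_2k_2(u)h_2(v)&\text{in }\Omega_T\cap\{v>0\},\\ u=g_1,\ v=g_2&\text{on }\partial_p\Omega_T,\\ u=|\nabla u|=0&\text{on }\Omega_T\cap\partial\{u>0\},\\ v=|\nabla v|=0&\text{on }\Omega_T\cap\partial\{v>0\}.\end{cases}$$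
   Context: Notation: $\mathbb R_+=[0,\infty)$; $\Omega\subset\mathbb R^n$ ($n\ge1$) is a bounded domain, $T>0$, $\Omega_T=\Omega\times(-T,0]$, $\partial_p\Omega_T=(\partial\Omega\times[-T,0])\cup(\Omega\times\{-T\})$; $\nabla$ is the spatial gradient; for $X=(x,t)$, $Y=(y,s)$, $d(X,Y)=\max(|x-y|,|t-s|^{1/2})$; $Q_r^2(X^0)=B_r(x_0)\times(t_0-r^2,t_0]$ for $X^0=(x_0,t_0)$. $M_0>0$ is a fixed constant with $\|g_i\|_{L^\infty(\partial_p\Omega_T)}\le M_0$. Class $\mathcal H$: functions $h:\mathbb R\to\mathbb R_+$ such that, for some constants $-1<a<1$ and $C^0>0$: $h=0$ on $(-\infty,0]$; $h$ is positive and continuous on $(0,\infty)$; $h(t)\le C^0t^a$ for $0<t<M_0$; $h$ is bounded on $[M_0,\infty)$. (The constants for $h_i$ may depend on $i$.) Class $\mathcal K$: functions $k:\mathbb R\to\mathbb R_+$ with $k=0$ on $(-\infty,0]$ and $k$ non-decreasing and continuous on $\mathbb R$. Class $\widetilde{\mathcal H}$ (with the constants $a,C^0$ of the given $h\in\mathcal H$): functions $\tilde h:\mathbb R\to\mathbb R_+$ such that for some $\tilde c>0$: $\tilde h=0$ on $(-\infty,\tilde c]$; $\tilde h$ is bounded and Lipschitz on $\mathbb R$; $0<\tilde h(t)\le C^0t^a+2$ for $t\in(\tilde c,\infty)$. Operators: $\mathcal F(\Omega_T)$ is a class of nonnegative continuous functions on $\Omega_T$, $\mathcal A(\Omega_T;\mathbb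 R_+)$ is the space of nonnegative measurable functions on $\Omega_T$, and $\mathcal L:\mathcal F(\Omega_T)\to\mathcal A(\Omega_T;\mathbb R_+)$. Equations are understood in a fixed notion of solution attached to $\mathcal L$ (e.g. weak or viscosity), deliberately left unspecified; what is required of it is the following. Solvability: For any $g\in C(\partial_p\Omega_T;\mathbb R_+)$, $f\in L^\infty(\Omega_T;\mathbb R_+)$ and $\tilde h\in\widetilde{\mathcal H}$ there exists a solution $w\in\mathcal F(\Omega_T)$ of $\mathcal Lw-\partial_tw=f\tilde h(w)$ in $\Omega_T$, $w=g$ on $\partial_p\Omega_T$, such that for every $K\Subset\Omega_T$: (i) $|w(X^1)-w(X^2)|\le\rho(d(X^1,X^2))$ for all $X^1,X^2\in K$; and (ii) $\sup_{Q_r^2(Z)\cap K}w\le C(r^{1+\alpha}+w(Z))$ for all $Z\in K$, $r>0$; where $C>0$ and $0<\alpha<1$ are constants and $\rho$ is a modulus of continuity depending only on $\Omega_T,K,\mathcal L,a,\|f\|_\infty,\|g\|_\infty$. Moreover, there exists a function $w_*$ in $\Omega_T$, depending only on $h,\|f\|_\infty,g$ and $\Omega_T$, with $w_*\le w$ in $\Omega_T$ and $w_*=g$ on $\partial_p\Omega_T$. Comparison: Let $g\in C(\partial_p\Omega_T;\mathbb R_+)$, $f_1,f_2\in L^\infty(\Omega_T;\mathbb R_+)$, $\tilde h\in\widetilde{\mathcal H}$, and let $w_j$ ($j=1,2$) be solutions of $\mathcal Lw_j-\partial_tw_j=f_j\tilde h(w_j)$ in $\Omega_T$, $w_j=g$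 on $\partial_p\Omega_T$. If $f_1<f_2$ in $\Omega_T$, then $w_1\ge w_2$ in $\Omega_T$. Convergence: Let $g\in C(\partial_p\Omega_T;\mathbb R_+)$ and, for each $j\in\mathbb N$, let $w_j\in\mathcal F(\Omega_T)$, $\tilde h^j\in\widetilde{\mathcal H}$, $f^j\in L^\infty(\Omega_T;\mathbb R_+)$ satisfy $\mathcal Lw_j-\partial_tw_j=f^j\tilde h^j(w_j)$ in $\Omega_T\cap\{w_j>0\}$, $w_j=g$ on $\partial_p\Omega_T$. Suppose $\sup_j\|f^j\|_{L^\infty(\Omega_T)}<\infty$, $f^j\to f$ and $w_j\to w$ locally uniformly in $\Omega_T$ for some $f\in L^\infty(\Omega_T)$, $w\in C(\Omega_T;\mathbb R_+)$, and $\tilde h^j\to\tilde h$ locally uniformly on $(0,\infty)$ for some $\tilde h\in\mathcal H\cup\widetilde{\mathcal H}$. Then $w\in\mathcal F(\Omega_T)$ and $\mathcal Lw-\partial_tw=f\tilde h(w)$ in $\Omega_T\cap\{w>0\}$. For $\mathcal L_i$ these properties are taken with $h=h_i$. *)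

theory Defs
  imports "HOL-Analysis.Analysis" "HOL-Probability.Essential_Supremum"
begin

text \<open>Functions on a subset of space-time are total functions of which only the values on
  that subset matter.\<close>

type_synonym 'n point = "(real, 'n) vec \<times> real"
type_synonym 'n field = "'n point \<Rightarrow> real"
type_synonym 'n operator = "'n field \<Rightarrow> 'n field"

text \<open>A notion of solution \<open>sol\<close>: the proposition \<open>sol L D w F\<close> stands for
  ``\<open>L w - \<partial>\<^sub>t w = F\<close> in \<open>D\<close>''.\<close>

type_synonym 'n solution_notion =
  "'n operator \<Rightarrow> 'n point set \<Rightarrow> 'n field \<Rightarrow> 'n field \<Rightarrow> bool"


subsection \<open>Parabolic geometry\<close>

definition bounded_domain :: "(real ^ 'n) set \<Rightarrow> bool" where
  "bounded_domain \<Omega> \<longleftrightarrow> open \<Omega> \<and> connected \<Omega> \<and> \<Omega> \<noteq> {} \<and> bounded \<Omega>"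

definition cylinder :: "(real ^ 'n) set \<Rightarrow> real \<Rightarrow> 'n point set" where
  "cylinder \<Omega> T = \<Omega> \<times> {-T<..0}"

definition parabolic_boundary :: "(real ^ 'n) set \<Rightarrow> real \<Rightarrow> 'n point set" where
  "parabolic_boundary \<Omega> T = (frontier \<Omega> \<times> {-T..0}) \<union> (\<Omega> \<times> {-T})"

definition parabolic_dist :: "('n::finite) point \<Rightarrow> 'n point \<Rightarrow> real" where
  "parabolic_dist X Y = max (dist (fst X) (fst Y)) (sqrt \<bar>snd X - snd Y\<bar>)"

definition parabolic_cylinder :: "real \<Rightarrow> ('n::finite) point \<Rightarrow> 'n point set" where
  "parabolic_cylinder r X0 = ball (fst X0) r \<times> {snd X0 - r^2 <.. snd X0}"

definition compactly_contained :: "('n::finite) point set \<Rightarrow> 'n point set \<Rightarrow> bool" where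
  "compactly_contained K S \<longleftrightarrow> compact (closure K) \<and> closure K \<subseteq> S"


subsection \<open>Function spaces\<close>

definition cont_nonneg :: "('n::finite) point set \<Rightarrow> 'n field set" where
  "cont_nonneg S = {w. continuous_on S w \<and> (\<forall>X\<in>S. 0 \<le> w X)}"

definition sup_norm :: "('n::finite) point set \<Rightarrow> 'n field \<Rightarrow> real" where
  "sup_norm S g = (SUP X\<in>S. \<bar>g X\<bar>)"

definition Linf_esssup :: "('n::finite) point set \<Rightarrow> 'n field \<Rightarrow> ereal" where
  "Linf_esssup S f = esssup (lebesgue_on S) (\<lambda>X. ereal \<bar>f X\<bar>)"

definition Linf :: "('n::finite) point set \<Rightarrow> 'n field set" where
  "Linf S = {f. f \<in> borel_measurable (lebesgue_on S) \<and> Linf_esssup S f < \<infinity>}"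

definition Linf_nonneg :: "('n::finite) point set \<Rightarrow> 'n field set" where
  "Linf_nonneg S = {f \<in> Linf S. \<forall>X\<in>S. 0 \<le> f X}"

definition Linf_norm :: "('n::finite) point set \<Rightarrow> 'n field \<Rightarrow> real" where
  "Linf_norm S f = real_of_ereal (Linf_esssup S f)"

definition meas_nonneg :: "('n::finite) point set \<Rightarrow> 'n field set" where
  "meas_nonneg S = {f \<in> borel_measurable (lebesgue_on S). \<forall>X\<in>S. 0 \<le> f X}"

definition locally_uniform_limit ::
    "'a::metric_space set \<Rightarrow> (nat \<Rightarrow> 'a \<Rightarrow> real) \<Rightarrow> ('a \<Rightarrow> real) \<Rightarrow> bool" where
  "locally_uniform_limit S ws w \<longleftrightarrow>
     (\<forall>K. compact K \<and> K \<subseteq> S \<longrightarrow> uniform_limit K ws w sequentially)"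

text \<open>Locally uniform convergence of \<open>L\<^sup>\<infinity>\<close> functions, which are determined only up to null sets.\<close>

definition Linf_loc_limit ::
    "('n::finite) point set \<Rightarrow> (nat \<Rightarrow> 'n field) \<Rightarrow> 'n field \<Rightarrow> bool" where
  "Linf_loc_limit S fs f \<longleftrightarrow>
     (\<forall>K. compact K \<and> K \<subseteq> S \<longrightarrow>
       (\<forall>e>0. \<forall>\<^sub>F j in sequentially. AE X in lebesgue_on K. \<bar>fs j X - f X\<bar> < e))"

text \<open>Since \<open>\<Omega>\<^sub>T\<close> does not meet its parabolic boundary, \<open>w = g\<close> there means that the boundary
  values are attained continuously from \<open>\<Omega>\<^sub>T\<close>.\<close>

definition boundary_values :: "(real ^ 'n) set \<Rightarrow> real \<Rightarrow> 'n field \<Rightarrow> 'n field \<Rightarrow> bool" where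
  "boundary_values \<Omega> T w g \<longleftrightarrow>
     (\<forall>Y\<in>parabolic_boundary \<Omega> T. (w \<longlongrightarrow> g Y) (at Y within cylinder \<Omega> T))"

definition modulus_of_continuity :: "(real \<Rightarrow> real) \<Rightarrow> bool" where
  "modulus_of_continuity \<rho> \<longleftrightarrow>
     (\<forall>s\<ge>0. 0 \<le> \<rho> s) \<and> mono_on {0..} \<rho> \<and> (\<rho> \<longlongrightarrow> 0) (at_right 0)"


subsection \<open>Classes of nonlinearities\<close>

definition class_H_const :: "real \<Rightarrow> real \<Rightarrow> real \<Rightarrow> (real \<Rightarrow> real) set" where
  "class_H_const M0 a C0 = {h.
     (\<forall>t. 0 \<le> h t) \<and> (\<forall>t\<le>0. h t = 0) \<and>
     (\<forall>t>0. 0 < h t) \<and> continuous_on {0<..} h \<and>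
     (\<forall>t. 0 < t \<and> t < M0 \<longrightarrow> h t \<le> C0 * t powr a) \<and>
     bounded (h ` {M0..})}"

definition class_H :: "real \<Rightarrow> (real \<Rightarrow> real) set" where
  "class_H M0 = {h. \<exists>a C0. -1 < a \<and> a < 1 \<and> 0 < C0 \<and> h \<in> class_H_const M0 a C0}"

definition class_K :: "(real \<Rightarrow> real) set" where
  "class_K = {k. (\<forall>t. 0 \<le> k t) \<and> (\<forall>t\<le>0. k t = 0) \<and> mono k \<and> continuous_on UNIV k}"

definition class_H_tilde :: "real \<Rightarrow> real \<Rightarrow> (real \<Rightarrow> real) set" where
  "class_H_tilde a C0 = {h. \<exists>c>0.
     (\<forall>t\<le>c. h t = 0) \<and>
     bounded (range h) \<and> (\<exists>B. B-lipschitz_on UNIV h) \<and>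
     (\<forall>t>c. 0 < h t \<and> h t \<le> C0 * t powr a + 2)}"


subsection \<open>Structural properties of an operator\<close>

text \<open>The typing of \<open>L\<close> as an operator on a class of nonnegative continuous functions, and the
  fact that an equation valid in a set is valid in its (relatively open) subsets, which is part
  of what is meant by an equation holding in a set.\<close>

definition operator_on ::
    "(real ^ 'n) set \<Rightarrow> real \<Rightarrow> 'n solution_notion \<Rightarrow> 'n operator \<Rightarrow> 'n field set \<Rightarrow> bool" where
  "operator_on \<Omega> T sol L \<F> \<longleftrightarrow>
     \<F> \<subseteq> cont_nonneg (cylinder \<Omega> T) \<and>
     (\<forall>w\<in>\<F>. L w \<in> meas_nonneg (cylinder \<Omega> T)) \<and>
     (\<forall>w\<in>\<F>. \<forall>D D' F.
        openin (top_of_set (cylinder \<Omega> T)) D \<longrightarrow>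
        openin (top_of_set (cylinder \<Omega> T)) D' \<longrightarrow>
        D' \<subseteq> D \<longrightarrow> sol L D w F \<longrightarrow> sol L D' w F)"

text \<open>Dependence of \<open>C\<close>, \<open>\<alpha>\<close>, \<open>\<rho>\<close> only on \<open>K\<close> and the two norms (besides the fixed data), and of
  \<open>w\<^sub>*\<close> only on the norm of \<open>f\<close> and on \<open>g\<close>, is expressed by choosing them as functions of these
  quantities before \<open>g\<close>, \<open>f\<close> and the nonlinearity.\<close>

definition solvability ::
    "(real ^ 'n) set \<Rightarrow> real \<Rightarrow> real \<Rightarrow> real \<Rightarrow>
     'n solution_notion \<Rightarrow> 'n operator \<Rightarrow> 'n field set \<Rightarrow> bool" where
  "solvability \<Omega> T a C0 sol L \<F> \<longleftrightarrow>
     (\<exists>(C :: 'n point set \<Rightarrow> real \<Rightarrow> real \<Rightarrow> real)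
       (\<alpha> :: 'n point set \<Rightarrow> real \<Rightarrow> real \<Rightarrow> real)
       (\<rho> :: 'n point set \<Rightarrow> real \<Rightarrow> real \<Rightarrow> real \<Rightarrow> real)
       (w_low :: real \<Rightarrow> 'n field \<Rightarrow> 'n field).
        (\<forall>K M N. 0 < C K M N \<and> 0 < \<alpha> K M N \<and> \<alpha> K M N < 1 \<and> modulus_of_continuity (\<rho> K M N)) \<and>
        (\<forall>g \<in> cont_nonneg (parabolic_boundary \<Omega> T).
         \<forall>f \<in> Linf_nonneg (cylinder \<Omega> T).
         \<forall>h \<in> class_H_tilde a C0.
           let M = Linf_norm (cylinder \<Omega> T) f;
               N = sup_norm (parabolic_boundary \<Omega> T) g
           in boundary_values \<Omega> T (w_low M g) g \<and>
              (\<exists>w\<in>\<F>.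
                 sol L (cylinder \<Omega> T) w (\<lambda>X. f X * h (w X)) \<and>
                 boundary_values \<Omega> T w g \<and>
                 (\<forall>X\<in>cylinder \<Omega> T. w_low M g X \<le> w X) \<and>
                 (\<forall>K. compactly_contained K (cylinder \<Omega> T) \<longrightarrow>
                    (\<forall>X1\<in>K. \<forall>X2\<in>K. \<bar>w X1 - w X2\<bar> \<le> \<rho> K M N (parabolic_dist X1 X2)) \<and>
                    (\<forall>Z\<in>K. \<forall>r>0. (SUP X\<in>parabolic_cylinder r Z \<inter> K. w X)
                        \<le> C K M N * (r powr (1 + \<alpha> K M N) + w Z))))))"

definition comparison ::
    "(real ^ 'n) set \<Rightarrow> real \<Rightarrow> real \<Rightarrow> real \<Rightarrow>
     'n solution_notion \<Rightarrow> 'n operator \<Rightarrow> 'n field set \<Rightarrow> bool" where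
  "comparison \<Omega> T a C0 sol L \<F> \<longleftrightarrow>
     (\<forall>g \<in> cont_nonneg (parabolic_boundary \<Omega> T).
      \<forall>f1 \<in> Linf_nonneg (cylinder \<Omega> T).
      \<forall>f2 \<in> Linf_nonneg (cylinder \<Omega> T).
      \<forall>h \<in> class_H_tilde a C0.
      \<forall>w1\<in>\<F>. \<forall>w2\<in>\<F>.
        sol L (cylinder \<Omega> T) w1 (\<lambda>X. f1 X * h (w1 X)) \<longrightarrow> boundary_values \<Omega> T w1 g \<longrightarrow>
        sol L (cylinder \<Omega> T) w2 (\<lambda>X. f2 X * h (w2 X)) \<longrightarrow> boundary_values \<Omega> T w2 g \<longrightarrow>
        (\<forall>X\<in>cylinder \<Omega> T. f1 X < f2 X) \<longrightarrow>
        (\<forall>X\<in>cylinder \<Omega> T. w2 X \<le> w1 X))"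

definition convergence ::
    "(real ^ 'n) set \<Rightarrow> real \<Rightarrow> real \<Rightarrow> real \<Rightarrow> real \<Rightarrow>
     'n solution_notion \<Rightarrow> 'n operator \<Rightarrow> 'n field set \<Rightarrow> bool" where
  "convergence \<Omega> T M0 a C0 sol L \<F> \<longleftrightarrow>
     (\<forall>g \<in> cont_nonneg (parabolic_boundary \<Omega> T).
      \<forall>ws hs fs w h f.
        (\<forall>j::nat. ws j \<in> \<F> \<and> hs j \<in> class_H_tilde a C0 \<and> fs j \<in> Linf_nonneg (cylinder \<Omega> T) \<and>
           sol L (cylinder \<Omega> T \<inter> {X. 0 < ws j X}) (ws j) (\<lambda>X. fs j X * hs j (ws j X)) \<and>
           boundary_values \<Omega> T (ws j) g) \<longrightarrow>
        bdd_above (range (\<lambda>j. Linf_norm (cylinder \<Omega> T) (fs j))) \<longrightarrow>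
        f \<in> Linf (cylinder \<Omega> T) \<longrightarrow> Linf_loc_limit (cylinder \<Omega> T) fs f \<longrightarrow>
        w \<in> cont_nonneg (cylinder \<Omega> T) \<longrightarrow> locally_uniform_limit (cylinder \<Omega> T) ws w \<longrightarrow>
        h \<in> class_H M0 \<union> class_H_tilde a C0 \<longrightarrow> locally_uniform_limit {0<..} hs h \<longrightarrow>
        w \<in> \<F> \<and> sol L (cylinder \<Omega> T \<inter> {X. 0 < w X}) w (\<lambda>X. f X * h (w X)))"


subsection \<open>Free boundary\<close>

text \<open>The boundary of the positivity set is taken relative to \<open>\<Omega>\<^sub>T\<close>: in the ambient space every
  positivity point at the top time \<open>t = 0\<close> would be a boundary point.\<close>

definition free_boundary :: "(real ^ 'n) set \<Rightarrow> real \<Rightarrow> 'n field \<Rightarrow> 'n point set" where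
  "free_boundary \<Omega> T w =
     (top_of_set (cylinder \<Omega> T)) frontier_of (cylinder \<Omega> T \<inter> {X. 0 < w X})"

definition free_boundary_condition :: "(real ^ 'n) set \<Rightarrow> real \<Rightarrow> 'n field \<Rightarrow> bool" where
  "free_boundary_condition \<Omega> T w \<longleftrightarrow>
     (\<forall>(x, t) \<in> free_boundary \<Omega> T w. w (x, t) = 0 \<and> (GDERIV (\<lambda>y. w (y, t)) x :> 0))"

end

theory Submission
  imports Defs "HOL-Complex_Analysis.Great_Picard"
begin

text \<open>
  The solution is a limit of solutions of systems with Lipschitz nonlinearities, and each of these
  is obtained by a monotone iteration.

  \<^emph>\<open>Monotone iteration.\<close> If \<open>v\<close> grows, the source \<open>f1 * k1(v)\<close> grows and, by comparison, the solution
  \<open>u\<close> of the first equation drops; if \<open>u\<close> drops, the source \<open>f2 * k2(u)\<close> drops and the solution \<open>v\<close> of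
  the second equation grows. Solving the two equations alternately therefore gives a decreasing
  sequence of \<open>u\<close>'s and an increasing sequence of \<open>v\<close>'s. Since each equation involves consecutive
  iterates, convergence along a subsequence would not be enough; monotonicity makes the whole
  sequences converge, and the limit solves the coupled equations (\<open>regularized_solution\<close>). The
  solutions with zero source lie above all iterates, so that \<open>k1(v)\<close> and \<open>k2(u)\<close> stay bounded
  (\<open>ex_upper_barrier\<close>).

  \<^emph>\<open>Padding.\<close> Comparison asks for strictly ordered sources, and the constants, the modulus and
  the lower barrier given by Solvability are arbitrary functions of the exact essential supremum of
  the source: two sources with nearly equal suprema may come with unrelated constants. Both points
  are settled by modifying the sources. In a thin layer above the initial time a source is replaced by a
  function with essential supremum \<open>M\<close>, a number that dominates all sources in question, and a
  parameter \<open>\<tau>\<close> makes the modified sources strictly monotone (\<open>padded_Linf\<close>,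
  \<open>padded_strict_mono\<close>). One set of constants then serves for the whole construction. The modification
  disappears in the limit because a compact subset of the cylinder misses a thin enough layer.

  \<^emph>\<open>Compactness.\<close> The functions that obey the estimates with these fixed constants form a class
  that is closed under pointwise limits and sequentially compact (\<open>W_closed\<close>,
  \<open>W_convergent_subsequence\<close>). Its members attain the boundary values, being squeezed between two
  barriers that do, and they satisfy the free boundary condition, because the growth
  estimate gives \<open>w \<le> C * r powr (1 + \<alpha>)\<close> at distance \<open>r\<close> from a zero. The theorem follows by letting
  the thickness of the layer tend to zero and the Lipschitz nonlinearities tend to \<open>h1\<close> and \<open>h2\<close>
  (\<open>coupled_solution\<close>).

  \<^emph>\<open>Large values.\<close> Beyond \<open>M0\<close> a nonlinearity \<open>h\<close> may exceed the bound \<open>C0 * t powr a + 2\<close> that all its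
  approximations have to satisfy. The product of source and nonlinearity does not change if \<open>h\<close> is
  divided and \<open>f\<close> is multiplied by the same constant, and after such a rescaling \<open>h\<close> can be approximated
  (\<open>class_H_rescale\<close>).
\<close>

section \<open>Nonlinearities\<close>

text \<open>Division by a bound of \<open>h\<close> on \<open>[M0, \<infinity>)\<close> makes \<open>h\<close> at most \<open>1\<close> there, and dividing by a number that
  is at least \<open>1\<close> respects the bound \<open>C0 * t powr a\<close> below \<open>M0\<close>.\<close>
lemma class_H_rescale:
  assumes "h \<in> class_H_const M0 a C0" "0 < C0"
  obtains N where "1 \<le> N" "(\<lambda>t. h t / N) \<in> class_H_const M0 a C0"
    "\<And>t. 0 < t \<Longrightarrow> h t / N \<le> C0 * t powr a + 1"
proof -
  have h: "\<And>t. 0 \<le> h t" "\<And>t. t \<le> 0 \<Longrightarrow> h t = 0" "\<And>t. 0 < t \<Longrightarrow> 0 < h t"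
    "continuous_on {0<..} h" "\<And>t. 0 < t \<Longrightarrow> t < M0 \<Longrightarrow> h t \<le> C0 * t powr a" "bounded (h ` {M0..})"
    using assms(1) unfolding class_H_const_def by auto
  obtain b where b: "\<And>t. M0 \<le> t \<Longrightarrow> \<bar>h t\<bar> \<le> b"
    using h(6) unfolding bounded_real by auto
  define N where "N = max 1 b"
  have N: "1 \<le> N" "b \<le> N" by (auto simp: N_def)
  have le: "h t / N \<le> h t" for t
    using h(1)[of t] N(1) by (simp add: divide_le_eq mult_right_le_one_le mult_le_cancel_left1)
  have small: "h t / N \<le> C0 * t powr a" if "0 < t" "t < M0" for t
    using le[of t] h(5)[OF that] by linarith
  have large: "h t / N \<le> 1" if "M0 \<le> t" for t
    using b[OF that] N h(1)[of t] by (simp add: divide_le_eq)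
  show thesis
  proof (rule that[OF N(1)])
    show "(\<lambda>t. h t / N) \<in> class_H_const M0 a C0"
      unfolding class_H_const_def
    proof (intro CollectI conjI)
      show "bounded ((\<lambda>t. h t / N) ` {M0..})"
        unfolding bounded_real using large h(1) N(1) by (intro exI[of _ 1]) auto
    qed (use h N small in \<open>auto intro!: continuous_on_divide\<close>)
    show "h t / N \<le> C0 * t powr a + 1" if "0 < t" for t
    proof (cases "t < M0")
      case True
      with small[OF that] show ?thesis by linarith
    next
      case False
      with large[of t] assms(2) show ?thesis by (simp add: add_increasing)
    qed
  qed
qed

text \<open>The Pasch--Hausdorff envelope: the largest \<open>L\<close>-Lipschitz function below \<open>H\<close>.\<close>
definition inf_convolution :: "real \<Rightarrow> (real \<Rightarrow> real) \<Rightarrow> real \<Rightarrow> real" where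
  "inf_convolution L H t = (INF s. H s + L * \<bar>t - s\<bar>)"

lemma inf_convolution_greatest:
  "(\<And>s. b \<le> H s + L * \<bar>t - s\<bar>) \<Longrightarrow> b \<le> inf_convolution L H t"
  unfolding inf_convolution_def by (rule cINF_greatest) auto

context
  fixes L :: real and H :: "real \<Rightarrow> real"
  assumes L: "0 \<le> L" and H: "\<And>s. 0 \<le> H s"
begin

lemma inf_convolution_lower: "inf_convolution L H t \<le> H s + L * \<bar>t - s\<bar>"
  unfolding inf_convolution_def
  by (rule cINF_lower) (auto intro!: bdd_belowI2[where m=0] add_nonneg_nonneg mult_nonneg_nonneg L H)

lemma inf_convolution_nonneg: "0 \<le> inf_convolution L H t"
  by (rule inf_convolution_greatest) (simp add: L H)

lemma inf_convolution_le: "inf_convolution L H t \<le> H t"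
  using inf_convolution_lower[of t t] by simp

lemma lipschitz_inf_convolution: "L-lipschitz_on UNIV (inf_convolution L H)"
proof -
  have *: "inf_convolution L H x - L * \<bar>x - y\<bar> \<le> inf_convolution L H y" for x y
  proof (rule inf_convolution_greatest)
    fix s
    have "L * \<bar>x - s\<bar> \<le> L * (\<bar>x - y\<bar> + \<bar>y - s\<bar>)"
      by (intro mult_left_mono L) auto
    then show "inf_convolution L H x - L * \<bar>x - y\<bar> \<le> H s + L * \<bar>y - s\<bar>"
      using inf_convolution_lower[of x s] by (simp add: distrib_left)
  qed
  show ?thesis
  proof (rule lipschitz_onI)
    fix x y :: real
    show "dist (inf_convolution L H x) (inf_convolution L H y) \<le> L * dist x y"
      using *[of x y] *[of y x] by (simp add: dist_real_def abs_minus_commute abs_le_iff)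
  qed (rule L)
qed

end

text \<open>The approximations are the envelopes of \<open>h\<close> cut off to \<open>0\<close> on \<open>(-\<infinity>, c]\<close> with \<open>c = 1 / Suc j\<close>, with
  Lipschitz constant \<open>Suc j\<close>. The cut-off keeps the envelope zero up to \<open>c\<close> and, when \<open>h\<close> is singular at
  \<open>0\<close>, bounded; lying below \<open>h\<close>, the envelope inherits the upper bound.\<close>
lemma lipschitz_approximation:
  assumes h: "h \<in> class_H_const M0 a C0"
    and bound: "\<And>t. 0 < t \<Longrightarrow> h t \<le> C0 * t powr a + 1"
  obtains hs :: "nat \<Rightarrow> real \<Rightarrow> real"
  where "\<And>j. hs j \<in> class_H_tilde a C0" "locally_uniform_limit {0<..} hs h"
proof -
  have h: "\<And>t. 0 \<le> h t" "\<And>t. 0 < t \<Longrightarrow> 0 < h t"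
    "continuous_on {0<..} h" "bounded (h ` {M0..})"
    using h unfolding class_H_const_def by auto
  define H where "H j s = (if s \<le> 1 / real (Suc j) then 0 else h s)" for j :: nat and s
  define hs where "hs j = inf_convolution (real (Suc j)) (H j)" for j
  have H: "0 \<le> H j s" for j s by (simp add: H_def h)
  have Hh: "H j s \<le> h s" for j s by (simp add: H_def h)
  have greatest: "(\<And>s. b \<le> H j s + real (Suc j) * \<bar>t - s\<bar>) \<Longrightarrow> b \<le> hs j t" for b j t
    unfolding hs_def by (rule inf_convolution_greatest)
  have nonneg: "0 \<le> hs j t" for j t
    unfolding hs_def by (rule inf_convolution_nonneg[OF of_nat_0_le_iff H])
  have le_H: "hs j t \<le> H j t" for j t
    unfolding hs_def by (rule inf_convolution_le[OF of_nat_0_le_iff H])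
  have tilde: "hs j \<in> class_H_tilde a C0" for j
  proof -
    define c where "c = 1 / real (Suc j)"
    have c: "0 < c" by (simp add: c_def)
    have "bounded (h ` {c..M0})"
      using c by (intro compact_imp_bounded compact_continuous_image continuous_on_subset[OF h(3)]) auto
    then have "bounded (h ` ({c..M0} \<union> {M0..}))"
      using h(4) by (simp add: image_Un)
    then have "bounded (h ` {c..})"
      by (rule bounded_subset) auto
    then obtain b where b: "\<And>t. c \<le> t \<Longrightarrow> \<bar>h t\<bar> \<le> b"
      unfolding bounded_real by auto
    have b0: "0 \<le> b" using b[of c] by simp
    have "H j t \<le> b" for t
      using b[of t] b0 by (auto simp: H_def c_def)
    then have bdd: "bounded (range (hs j))"
      unfolding bounded_real using le_H[of j] nonneg[of j]
      by (intro exI[of _ b]) (force intro: order_trans)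
    have zero: "hs j t = 0" if "t \<le> c" for t
      using le_H[of j t] nonneg[of j t] that by (auto simp: H_def c_def)
    have pos: "0 < hs j t" if t: "c < t" for t
    proof -
      define m where "m = (c + t) / 2"
      have m: "c < m" "m < t" using t by (auto simp: m_def)
      \<comment> \<open>Near \<open>t\<close> the infimum stays above the minimum of \<open>h\<close>, away from \<open>t\<close> above the penalty.\<close>
      have "continuous_on {m..2*t} h"
        using m c by (intro continuous_on_subset[OF h(3)]) auto
      moreover have "{m..2*t} \<noteq> {}" using m c by auto
      ultimately obtain p where p: "p \<in> {m..2*t}" "\<And>s. s \<in> {m..2*t} \<Longrightarrow> h p \<le> h s"
        using continuous_attains_inf[of "{m..2*t}" h] by blast
      have hp: "0 < h p" using p(1) m c by (intro h(2)) auto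
      have "min (h p) (real (Suc j) * (t - m)) \<le> hs j t"
      proof (rule greatest)
        fix s
        consider "s < m" | "2 * t < s" | "m \<le> s" "s \<le> 2 * t" by linarith
        then show "min (h p) (real (Suc j) * (t - m)) \<le> H j s + real (Suc j) * \<bar>t - s\<bar>"
        proof cases
          case 1
          have "real (Suc j) * (t - m) \<le> real (Suc j) * \<bar>t - s\<bar>"
            using 1 m by (intro mult_left_mono) auto
          then show ?thesis using H[of j s] by linarith
        next
          case 2
          have "real (Suc j) * (t - m) \<le> real (Suc j) * \<bar>t - s\<bar>"
            using 2 m c by (intro mult_left_mono) auto
          then show ?thesis using H[of j s] by linarith
        next
          case 3
          then have "h p \<le> H j s" using p(2)[of s] m by (auto simp: H_def c_def)
          moreover have "0 \<le> real (Suc j) * \<bar>t - s\<bar>" by simp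
          ultimately show ?thesis by linarith
        qed
      qed
      moreover have "0 < min (h p) (real (Suc j) * (t - m))"
        using hp m by simp
      ultimately show ?thesis by linarith
    qed
    have up: "hs j t \<le> C0 * t powr a + 2" if "c < t" for t
      using le_H[of j t] Hh[of j t] bound[of t] that c by linarith
    have "\<exists>B. B-lipschitz_on UNIV (hs j)"
      using lipschitz_inf_convolution[of "real (Suc j)" "H j"] H unfolding hs_def by auto
    then show ?thesis
      unfolding class_H_tilde_def using c zero bdd pos up by blast
  qed
  have limit: "locally_uniform_limit {0<..} hs h"
    unfolding locally_uniform_limit_def
  proof (intro allI impI)
    fix K :: "real set" assume K: "compact K \<and> K \<subseteq> {0<..}"
    show "uniform_limit K hs h sequentially"
    proof (cases "K = {}")
      case False
      obtain p where p: "p \<in> K" "\<And>t. t \<in> K \<Longrightarrow> p \<le> t"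
        using compact_attains_inf[of K] K False by auto
      obtain q where q: "q \<in> K" "\<And>t. t \<in> K \<Longrightarrow> t \<le> q"
        using compact_attains_sup[of K] K False by auto
      have p0: "0 < p" using p K by auto
      define I where "I = {p/2..2*q}"
      have Ipos: "I \<subseteq> {0<..}" using p0 by (auto simp: I_def)
      have contI: "continuous_on I h" using Ipos h(3) continuous_on_subset by blast
      have "bounded (h ` I)"
        using contI by (intro compact_imp_bounded compact_continuous_image) (auto simp: I_def)
      then obtain b where b: "\<And>t. t \<in> I \<Longrightarrow> \<bar>h t\<bar> \<le> b"
        unfolding bounded_real by auto
      show ?thesis
      proof (rule uniform_limitI)
        fix e :: real assume e: "0 < e"
        have "uniformly_continuous_on I h"
          using contI by (intro compact_uniformly_continuous) (auto simp: I_def)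
        then obtain d where d: "0 < d"
          "\<forall>s\<in>I. \<forall>t\<in>I. dist t s < d \<longrightarrow> dist (h t) (h s) < e / 2"
          using half_gt_zero[OF e] unfolding uniformly_continuous_on_def by blast
        define d' where "d' = min d (p/2)"
        have d': "0 < d'" "d' \<le> d" "d' \<le> p/2" using d p0 by (auto simp: d'_def)
        \<comment> \<open>Points closer than \<open>d'\<close> are handled by uniform continuity and by the cut-off lying below \<open>p/2\<close>;
          for the others the penalty alone exceeds the bound \<open>b\<close> of \<open>h\<close>.\<close>
        have "\<forall>\<^sub>F j in sequentially. inverse (real (Suc j)) < p/2"
          using p0 by (intro order_tendstoD(2)[OF LIMSEQ_inverse_real_of_nat]) auto
        moreover have "filterlim (\<lambda>j. real (Suc j)) at_top sequentially"
          by (rule filterlim_compose[OF filterlim_real_sequentially filterlim_Suc])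
        then have "\<forall>\<^sub>F j in sequentially. b / d' \<le> real (Suc j)"
          unfolding filterlim_at_top by blast
        ultimately show "\<forall>\<^sub>F j in sequentially. \<forall>t\<in>K. dist (hs j t) (h t) < e"
        proof eventually_elim
          case (elim j)
          show ?case
          proof
            fix t assume "t \<in> K"
            then have t: "p \<le> t" "t \<le> q" using p q by auto
            then have tI: "t \<in> I" using p0 by (auto simp: I_def)
            have "h t - e / 2 \<le> hs j t"
            proof (rule greatest)
              fix s
              show "h t - e / 2 \<le> H j s + real (Suc j) * \<bar>t - s\<bar>"
              proof (cases "\<bar>t - s\<bar> < d'")
                case True
                then have sI: "s \<in> I" using t d' p0 by (auto simp: I_def)
                have "\<bar>h s - h t\<bar> < e / 2"
                  using bspec[OF bspec[OF d(2) tI] sI] True d' by (simp add: dist_real_def abs_minus_commute)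
                moreover have "H j s = h s"
                  using elim(1) sI by (auto simp: H_def I_def inverse_eq_divide)
                moreover have "0 \<le> real (Suc j) * \<bar>t - s\<bar>" by simp
                ultimately show ?thesis by linarith
              next
                case False
                have "b \<le> real (Suc j) * d'"
                  using elim(2) d'(1) by (simp add: pos_divide_le_eq)
                also have "\<dots> \<le> real (Suc j) * \<bar>t - s\<bar>"
                  using False by (intro mult_left_mono) auto
                finally show ?thesis using b[OF tI] H[of j s] e by linarith
              qed
            qed
            moreover have "hs j t \<le> h t" using le_H[of j t] Hh[of j t] by linarith
            ultimately show "dist (hs j t) (h t) < e" using e by (simp add: dist_real_def)
          qed
        qed
      qed
    qed (simp add: uniform_limit_iff)
  qed
  show thesis by (rule that[OF tilde limit])
qed


section \<open>The space-time cylinder\<close>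

lemma parabolic_dist_nonneg: "0 \<le> parabolic_dist X Y"
  unfolding parabolic_dist_def by (simp add: le_max_iff_disj)

lemma parabolic_dist_small:
  assumes "0 < e"
  obtains d where "0 < d" "\<And>X Y. dist X Y < d \<Longrightarrow> parabolic_dist X Y < e"
proof
  show "0 < min e (e\<^sup>2)" using assms by simp
  fix X Y :: "(real^'n) \<times> real" assume *: "dist X Y < min e (e\<^sup>2)"
  have "dist (fst X) (fst Y) < e" using dist_fst_le[of X Y] * by linarith
  moreover have "\<bar>snd X - snd Y\<bar> < e\<^sup>2" using dist_snd_le[of X Y] * by (simp add: dist_real_def)
  then have "sqrt \<bar>snd X - snd Y\<bar> < e"
    using assms by (intro real_less_lsqrt) auto
  ultimately show "parabolic_dist X Y < e" unfolding parabolic_dist_def by simp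
qed

lemma modulus_of_continuity_small:
  assumes "modulus_of_continuity \<rho>" "0 < e"
  obtains d where "0 < d" "\<And>s. 0 \<le> s \<Longrightarrow> s < d \<Longrightarrow> \<rho> s < e"
proof -
  have "(\<rho> \<longlongrightarrow> 0) (at_right 0)"
    using assms unfolding modulus_of_continuity_def by blast
  then have "\<forall>\<^sub>F s in at_right 0. \<rho> s < e"
    using assms(2) by (rule order_tendstoD(2))
  then obtain d where d: "0 < d" "\<And>s. 0 < s \<Longrightarrow> s < d \<Longrightarrow> \<rho> s < e"
    unfolding eventually_at_right_field by blast
  show thesis
  proof (rule that[of d])
    fix s :: real assume s: "0 \<le> s" "s < d"
    have "mono_on {0..} \<rho>" using assms(1) unfolding modulus_of_continuity_def by blast
    then have "\<rho> s \<le> \<rho> ((s + d) / 2)" using s by (elim mono_onD) auto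
    also have "\<dots> < e" using s by (intro d(2)) auto
    finally show "\<rho> s < e" .
  qed (rule d(1))
qed

locale space_time_cylinder =
  fixes \<Omega> :: "(real ^ 'n) set" and T :: real
  assumes bounded_domain: "bounded_domain \<Omega>" and T_pos: "0 < T"
begin

abbreviation S :: "'n point set" where "S \<equiv> cylinder \<Omega> T"

lemma open_\<Omega>: "open \<Omega>" and bounded_\<Omega>: "bounded \<Omega>" and \<Omega>_nonempty: "\<Omega> \<noteq> {}"
  using bounded_domain unfolding bounded_domain_def by auto

lemma compact_neighbourhood:
  assumes "X \<in> S"
  obtains K U where "compact K" "K \<subseteq> S" "open U" "X \<in> U" "S \<inter> U \<subseteq> K"
proof -
  obtain x t where X: "X = (x, t)" "x \<in> \<Omega>" "-T < t" "t \<le> 0"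
    using assms unfolding cylinder_def by auto
  obtain e where e: "0 < e" "cball x e \<subseteq> \<Omega>"
    using open_\<Omega> X open_contains_cball by blast
  define b where "b = (t - T) / 2"
  have b: "-T < b" "b < t" using X by (auto simp: b_def)
  show thesis
  proof (rule that[of "cball x e \<times> {b..0}" "ball x e \<times> {b<..}"])
    show "compact (cball x e \<times> {b..0})" by (intro compact_Times) auto
    show "open (ball x e \<times> {b<..})" by (intro open_Times) auto
  qed (use X e b in \<open>auto simp: cylinder_def\<close>)
qed

text \<open>This is why a change of the sources in a layer above the initial time is invisible to locally
  uniform limits once the layer is thin.\<close>
lemma compact_above_bottom:
  assumes "compact K" "K \<subseteq> S"
  obtains \<eta> where "0 < \<eta>" "\<And>X. X \<in> K \<Longrightarrow> \<eta> \<le> snd X + T"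
proof (cases "K = {}")
  case False
  have "continuous_on K snd" by (intro continuous_intros)
  then obtain Y where Y: "Y \<in> K" "\<And>X. X \<in> K \<Longrightarrow> snd Y \<le> snd X"
    using continuous_attains_inf[OF assms(1) False] by blast
  have "0 < snd Y + T" using Y(1) assms(2) by (auto simp: cylinder_def)
  then show thesis using that[of "snd Y + T"] Y(2) by auto
qed (use that[of 1] in auto)

lemma compact_closure_S: "compact (closure S)"
  unfolding compact_closure cylinder_def
  using bounded_\<Omega> by (intro bounded_Times) auto

lemma closure_S: "closure S \<subseteq> S \<union> parabolic_boundary \<Omega> T"
proof -
  have "closure S \<subseteq> closure \<Omega> \<times> {-T..0}"
    unfolding cylinder_def closure_Times by (intro Sigma_mono closure_minimal order_refl) auto
  also have "\<dots> \<subseteq> S \<union> parabolic_boundary \<Omega> T"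
    using open_\<Omega> unfolding cylinder_def parabolic_boundary_def frontier_def
    by (auto simp: interior_open)
  finally show ?thesis .
qed

lemma sets_S: "S \<in> sets lebesgue"
proof -
  have "S \<in> sets borel" unfolding cylinder_def
    using open_\<Omega> by (intro borel_Times) auto
  then show ?thesis by simp
qed

text \<open>Along a sequence on which \<open>w\<close> were unbounded one could pass to a limit point in the compact
  closure of the cylinder; but \<open>w\<close> has a finite limit at every point there.\<close>
lemma bounded_if_boundary_values:
  assumes "continuous_on S w" "boundary_values \<Omega> T w g"
  shows "bounded (w ` S)"
proof (rule ccontr)
  assume "\<not> bounded (w ` S)"
  then have "\<forall>n. \<exists>X\<in>S. real n < \<bar>w X\<bar>"
    unfolding bounded_real by (auto simp: not_le)
  then obtain X where X: "\<And>n. X n \<in> S" "\<And>n. real n < \<bar>w (X n)\<bar>" by metis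
  obtain Y r where Y: "Y \<in> closure S" "strict_mono r" "(X \<circ> r) \<longlonglongrightarrow> Y"
    using compact_closure_S X(1) closure_subset unfolding compact_def by (metis subsetD)
  have "\<exists>l. (w \<longlongrightarrow> l) (at Y within S) \<and> (Y \<in> S \<longrightarrow> l = w Y)"
  proof (cases "Y \<in> S")
    case True
    then show ?thesis using assms(1) by (auto simp: continuous_on_def)
  next
    case False
    then have "Y \<in> parabolic_boundary \<Omega> T" using Y closure_S by auto
    then show ?thesis using assms(2) False unfolding boundary_values_def by auto
  qed
  then obtain l where l: "(w \<longlongrightarrow> l) (at Y within S)" "Y \<in> S \<Longrightarrow> l = w Y" by auto
  have "(\<lambda>n. w (X (r n))) \<longlonglongrightarrow> l"
  proof (rule tendstoI)
    fix e :: real assume e: "0 < e"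
    have "\<forall>\<^sub>F Z in at Y within S. dist (w Z) l < e" using l(1) e by (rule tendstoD)
    then have "\<forall>\<^sub>F Z in nhds Y. Z \<in> S \<longrightarrow> dist (w Z) l < e"
      unfolding eventually_at_filter using l(2) e by (auto elim!: eventually_mono)
    then have "\<forall>\<^sub>F n in sequentially. (X \<circ> r) n \<in> S \<longrightarrow> dist (w ((X \<circ> r) n)) l < e"
      using Y(3) by (rule eventually_compose_filterlim)
    then show "\<forall>\<^sub>F n in sequentially. dist (w (X (r n))) l < e" using X(1) by simp
  qed
  then have "bounded (range (\<lambda>n. w (X (r n))))" by (rule convergent_imp_bounded)
  then obtain b where b: "\<And>n. \<bar>w (X (r n))\<bar> \<le> b" unfolding bounded_real by auto
  obtain n where n: "b < real n" using reals_Archimedean2 by blast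
  have "real n \<le> real (r n)" using Y(2) by (simp add: seq_suble)
  then show False using X(2)[of "r n"] b[of n] n by linarith
qed

end


section \<open>A compact class of functions\<close>

text \<open>The conclusions of Solvability, with all constants fixed. The growth estimate is stated pointwise
  and not through a supremum, so that it passes to pointwise limits at once.\<close>
definition apriori_class :: "('n::finite) point set \<Rightarrow> ('n point set \<Rightarrow> real \<Rightarrow> real) \<Rightarrow>
    ('n point set \<Rightarrow> real) \<Rightarrow> ('n point set \<Rightarrow> real) \<Rightarrow> 'n field \<Rightarrow> 'n field \<Rightarrow> 'n field set" where
  "apriori_class S \<rho> C \<alpha> lo up = {w.
     (\<forall>X\<in>S. 0 \<le> w X \<and> lo X \<le> w X \<and> w X \<le> up X) \<and>
     (\<forall>K. compact K \<and> K \<subseteq> S \<longrightarrow>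
        (\<forall>X\<in>K. \<forall>Y\<in>K. \<bar>w X - w Y\<bar> \<le> \<rho> K (parabolic_dist X Y)) \<and>
        (\<forall>Z\<in>K. \<forall>r>0. \<forall>X\<in>parabolic_cylinder r Z \<inter> K. w X \<le> C K * (r powr (1 + \<alpha> K) + w Z)))}"

lemma apriori_class_change_barrier:
  assumes "\<And>X. X \<in> S \<Longrightarrow> w X \<le> up' X" "w \<in> apriori_class S \<rho> C \<alpha> lo up"
  shows "w \<in> apriori_class S \<rho> C \<alpha> lo up'"
  unfolding apriori_class_def
proof (rule CollectI, rule conjI)
  show "\<forall>X\<in>S. 0 \<le> w X \<and> lo X \<le> w X \<and> w X \<le> up' X"
    using assms(1) conjunct1[OF CollectD[OF assms(2)[unfolded apriori_class_def]]] by blast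
qed (rule conjunct2[OF CollectD[OF assms(2)[unfolded apriori_class_def]]])

locale apriori_estimates = space_time_cylinder \<Omega> T for \<Omega> :: "(real ^ 'n) set" and T +
  fixes \<rho> :: "'n point set \<Rightarrow> real \<Rightarrow> real" and C \<alpha> :: "'n point set \<Rightarrow> real"
    and lo up g :: "'n field"
  assumes modulus: "modulus_of_continuity (\<rho> K)" and \<alpha>_pos: "0 < \<alpha> K"
    and lo_boundary: "boundary_values \<Omega> T lo g" and up_boundary: "boundary_values \<Omega> T up g"
begin

abbreviation W :: "'n field set" where "W \<equiv> apriori_class S \<rho> C \<alpha> lo up"

lemma W_nonneg: "w \<in> W \<Longrightarrow> X \<in> S \<Longrightarrow> 0 \<le> w X"
  and W_lo: "w \<in> W \<Longrightarrow> X \<in> S \<Longrightarrow> lo X \<le> w X"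
  and W_up: "w \<in> W \<Longrightarrow> X \<in> S \<Longrightarrow> w X \<le> up X"
  unfolding apriori_class_def by auto

lemma W_modulus:
  "w \<in> W \<Longrightarrow> compact K \<Longrightarrow> K \<subseteq> S \<Longrightarrow> X \<in> K \<Longrightarrow> Y \<in> K \<Longrightarrow> \<bar>w X - w Y\<bar> \<le> \<rho> K (parabolic_dist X Y)"
  unfolding apriori_class_def by auto

lemma W_growth:
  "w \<in> W \<Longrightarrow> compact K \<Longrightarrow> K \<subseteq> S \<Longrightarrow> Z \<in> K \<Longrightarrow> X \<in> K \<Longrightarrow> 0 < r \<Longrightarrow> X \<in> parabolic_cylinder r Z \<Longrightarrow>
    w X \<le> C K * (r powr (1 + \<alpha> K) + w Z)"
  unfolding apriori_class_def by auto

text \<open>The equation enters the compactness arguments only through this uniform form of the modulus.\<close>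
lemma W_equicontinuous:
  assumes "compact K" "K \<subseteq> S" "0 < e"
  obtains d where "0 < d"
    "\<And>w X Y. w \<in> W \<Longrightarrow> X \<in> K \<Longrightarrow> Y \<in> K \<Longrightarrow> dist X Y < d \<Longrightarrow> \<bar>w X - w Y\<bar> < e"
proof -
  obtain s where s: "0 < s" "\<And>r. 0 \<le> r \<Longrightarrow> r < s \<Longrightarrow> \<rho> K r < e"
    by (rule modulus_of_continuity_small[OF modulus assms(3)]) blast
  obtain d where d: "0 < d" "\<And>X Y :: 'n point. dist X Y < d \<Longrightarrow> parabolic_dist X Y < s"
    by (rule parabolic_dist_small[OF s(1)]) blast
  show thesis
  proof (rule that[OF d(1)])
    fix w X Y assume *: "w \<in> W" "X \<in> K" "Y \<in> K" "dist X Y < d"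
    have "\<bar>w X - w Y\<bar> \<le> \<rho> K (parabolic_dist X Y)"
      using * by (intro W_modulus assms)
    also have "\<dots> < e"
      using * by (intro s(2) parabolic_dist_nonneg d(2))
    finally show "\<bar>w X - w Y\<bar> < e" .
  qed
qed

lemma W_continuous:
  assumes "w \<in> W"
  shows "continuous_on S w"
  unfolding continuous_on_def
proof
  fix X assume X: "X \<in> S"
  obtain K U where K: "compact K" "K \<subseteq> S" "open U" "X \<in> U" "S \<inter> U \<subseteq> K"
    by (rule compact_neighbourhood[OF X])
  show "(w \<longlongrightarrow> w X) (at X within S)"
  proof (rule tendstoI)
    fix e :: real assume "0 < e"
    then obtain d where d: "0 < d"
      "\<And>w X Y. w \<in> W \<Longrightarrow> X \<in> K \<Longrightarrow> Y \<in> K \<Longrightarrow> dist X Y < d \<Longrightarrow> \<bar>w X - w Y\<bar> < e"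
      using W_equicontinuous[OF K(1,2)] by blast
    show "\<forall>\<^sub>F Y in at X within S. dist (w Y) (w X) < e"
      unfolding eventually_at_topological
    proof (intro exI[of _ "U \<inter> ball X d"] conjI ballI impI)
      fix Y assume Y: "Y \<in> U \<inter> ball X d" "Y \<in> S"
      then have "Y \<in> K" "X \<in> K" using K X by auto
      then show "dist (w Y) (w X) < e"
        using d(2)[OF assms, of Y X] Y by (simp add: dist_real_def dist_commute)
    qed (use K d X in auto)
  qed
qed

lemma W_cont_nonneg: "w \<in> W \<Longrightarrow> w \<in> cont_nonneg S"
  unfolding cont_nonneg_def using W_continuous W_nonneg by auto

lemma W_boundary_values:
  assumes "w \<in> W"
  shows "boundary_values \<Omega> T w g"
  unfolding boundary_values_def
proof
  fix Y assume "Y \<in> parabolic_boundary \<Omega> T"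
  then have lim: "(lo \<longlongrightarrow> g Y) (at Y within S)" "(up \<longlongrightarrow> g Y) (at Y within S)"
    using lo_boundary up_boundary unfolding boundary_values_def by auto
  have "\<forall>\<^sub>F X in at Y within S. lo X \<le> w X" "\<forall>\<^sub>F X in at Y within S. w X \<le> up X"
    unfolding eventually_at_filter using W_lo[OF assms] W_up[OF assms] by (auto intro!: always_eventually)
  then show "(w \<longlongrightarrow> g Y) (at Y within S)"
    using lim by (rule tendsto_sandwich)
qed

lemma W_closed:
  assumes "\<And>j::nat. ws j \<in> W" and lim: "\<And>X. X \<in> S \<Longrightarrow> (\<lambda>j. ws j X) \<longlonglongrightarrow> w X"
  shows "w \<in> W"
  unfolding apriori_class_def
proof (intro CollectI conjI ballI allI impI)
  fix X assume X: "X \<in> S"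
  show "0 \<le> w X" "lo X \<le> w X"
    using W_nonneg[OF assms(1) X] W_lo[OF assms(1) X] by (auto intro: LIMSEQ_le_const[OF lim[OF X]])
  show "w X \<le> up X"
    using W_up[OF assms(1) X] by (auto intro: LIMSEQ_le_const2[OF lim[OF X]])
next
  fix K X Y assume K: "compact K \<and> K \<subseteq> S" and XY: "X \<in> K" "Y \<in> K"
  have "(\<lambda>j. \<bar>ws j X - ws j Y\<bar>) \<longlonglongrightarrow> \<bar>w X - w Y\<bar>"
    using K XY by (intro tendsto_intros lim) auto
  then show "\<bar>w X - w Y\<bar> \<le> \<rho> K (parabolic_dist X Y)"
    by (rule LIMSEQ_le_const2) (use W_modulus[OF assms(1)] K XY in blast)
next
  fix K Z X and r :: real
  assume K: "compact K \<and> K \<subseteq> S" and Z: "Z \<in> K" and r: "0 < r" and X: "X \<in> parabolic_cylinder r Z \<inter> K"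
  have "(\<lambda>j. ws j X) \<longlonglongrightarrow> w X"
    "(\<lambda>j. C K * (r powr (1 + \<alpha> K) + ws j Z)) \<longlonglongrightarrow> C K * (r powr (1 + \<alpha> K) + w Z)"
    using K X Z by (intro tendsto_intros lim; auto)+
  then show "w X \<le> C K * (r powr (1 + \<alpha> K) + w Z)"
    by (rule LIMSEQ_le) (use W_growth[OF assms(1)] K X Z r in blast)
qed

text \<open>Equicontinuity upgrades pointwise convergence: on a compact set it is enough to control a
  finite net.\<close>
lemma W_locally_uniform:
  assumes "\<And>j::nat. ws j \<in> W" and lim: "\<And>X. X \<in> S \<Longrightarrow> (\<lambda>j. ws j X) \<longlonglongrightarrow> w X"
  shows "locally_uniform_limit S ws w"
  unfolding locally_uniform_limit_def
proof (intro allI impI)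
  fix K assume K: "compact K \<and> K \<subseteq> S"
  have w: "w \<in> W" using assms by (rule W_closed)
  show "uniform_limit K ws w sequentially"
  proof (rule uniform_limitI)
    fix e :: real assume e: "0 < e"
    have "0 < e/3" using e by simp
    then obtain d where d: "0 < d"
      "\<And>w X Y. w \<in> W \<Longrightarrow> X \<in> K \<Longrightarrow> Y \<in> K \<Longrightarrow> dist X Y < d \<Longrightarrow> \<bar>w X - w Y\<bar> < e/3"
      using W_equicontinuous[OF conjunct1[OF K] conjunct2[OF K]] by blast
    have cover: "K \<subseteq> (\<Union>X\<in>K. ball X d)" using d(1) by auto
    obtain N where N: "N \<subseteq> K" "finite N" "K \<subseteq> (\<Union>X\<in>N. ball X d)"
      by (rule compactE_image[OF conjunct1[OF K] open_ball cover])
    have "\<forall>\<^sub>F j in sequentially. \<forall>X\<in>N. dist (ws j X) (w X) < e/3"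
    proof (rule eventually_ball_finite[OF N(2)], intro ballI)
      fix X assume "X \<in> N"
      then have "X \<in> S" using N(1) K by auto
      from tendstoD[OF lim[OF this] \<open>0 < e/3\<close>]
      show "\<forall>\<^sub>F j in sequentially. dist (ws j X) (w X) < e/3" .
    qed
    then show "\<forall>\<^sub>F j in sequentially. \<forall>Y\<in>K. dist (ws j Y) (w Y) < e"
    proof eventually_elim
      case (elim j)
      show ?case
      proof
        fix Y assume Y: "Y \<in> K"
        then obtain X where X: "X \<in> N" "dist X Y < d" using N(3) by auto
        have XK: "X \<in> K" using X N(1) by auto
        show "dist (ws j Y) (w Y) < e"
          using bspec[OF elim X(1)] d(2)[OF assms(1)[of j] XK Y X(2)] d(2)[OF w XK Y X(2)]
          unfolding dist_real_def by linarith
      qed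
    qed
  qed
qed

text \<open>The Arzela--Ascoli argument on a set that is only locally compact: a diagonal sequence
  converges on a countable dense set, and equicontinuity near each point spreads the convergence.\<close>
lemma W_convergent_subsequence:
  assumes "\<And>j::nat. ws j \<in> W" and bdd: "bounded (up ` S)"
  obtains r w where "strict_mono (r :: nat \<Rightarrow> nat)" "w \<in> W"
    "\<And>X. X \<in> S \<Longrightarrow> (\<lambda>j. ws (r j) X) \<longlonglongrightarrow> w X"
proof -
  obtain D where D: "countable D" "D \<subseteq> S" "S \<subseteq> closure D"
    using separable[of S] by blast
  obtain b where b: "\<And>X. X \<in> S \<Longrightarrow> \<bar>up X\<bar> \<le> b"
    using bdd unfolding bounded_real by auto
  have "norm (ws j X) \<le> b" if "X \<in> D" for j X
    using W_nonneg[OF assms(1), of X j] W_up[OF assms(1), of X j] b[of X] that D(2) by auto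
  then obtain r where r: "strict_mono (r :: nat \<Rightarrow> nat)"
    "\<And>X. X \<in> D \<Longrightarrow> \<exists>l. (\<lambda>j. ws (r j) X) \<longlonglongrightarrow> l"
    using function_convergent_subsequence[OF D(1), of ws b] by blast
  have "convergent (\<lambda>j. ws (r j) X)" if X: "X \<in> S" for X
  proof -
    obtain K U where K: "compact K" "K \<subseteq> S" "open U" "X \<in> U" "S \<inter> U \<subseteq> K"
      by (rule compact_neighbourhood[OF X])
    have "Cauchy (\<lambda>j. ws (r j) X)"
    proof (rule metric_CauchyI)
      fix e :: real assume e: "0 < e"
      then have e3: "0 < e/3" by simp
      then obtain d where d: "0 < d"
        "\<And>w X Y. w \<in> W \<Longrightarrow> X \<in> K \<Longrightarrow> Y \<in> K \<Longrightarrow> dist X Y < d \<Longrightarrow> \<bar>w X - w Y\<bar> < e/3"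
        using W_equicontinuous[OF K(1,2)] by blast
      have "open (U \<inter> ball X d)" "X \<in> U \<inter> ball X d" using K d by auto
      then obtain Y where Y: "Y \<in> D" "Y \<in> U \<inter> ball X d"
        using X D(3) closure_iff_nhds_not_empty[of X D] by blast
      then have YK: "Y \<in> K" "X \<in> K" "dist X Y < d" using K D X by auto
      have "Cauchy (\<lambda>j. ws (r j) Y)"
        using r(2)[OF Y(1)] by (auto intro: LIMSEQ_imp_Cauchy)
      then obtain M where M: "\<And>m n. M \<le> m \<Longrightarrow> M \<le> n \<Longrightarrow> dist (ws (r m) Y) (ws (r n) Y) < e/3"
        using metric_CauchyD[OF _ e3] by blast
      show "\<exists>M. \<forall>m\<ge>M. \<forall>n\<ge>M. dist (ws (r m) X) (ws (r n) X) < e"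
      proof (intro exI[of _ M] allI impI)
        fix m n assume "M \<le> m" "M \<le> n"
        then show "dist (ws (r m) X) (ws (r n) X) < e"
          using M[of m n] d(2)[OF assms(1)[of "r m"] YK(2,1,3)] d(2)[OF assms(1)[of "r n"] YK(2,1,3)]
          unfolding dist_real_def by linarith
      qed
    qed
    then show ?thesis by (simp add: Cauchy_convergent_iff)
  qed
  then have lim: "(\<lambda>j. ws (r j) X) \<longlonglongrightarrow> lim (\<lambda>j. ws (r j) X)" if "X \<in> S" for X
    using that by (simp add: convergent_LIMSEQ_iff)
  show thesis
    by (rule that[OF r(1) W_closed[OF _ lim] lim]) (use assms(1) in auto)
qed

text \<open>At a free boundary point \<open>w\<close> vanishes, since positivity is an open condition. With centre at that
  point the growth estimate bounds \<open>w\<close> at distance \<open>r\<close> by a multiple of \<open>r powr (1 + \<alpha>)\<close>, which is \<open>o(r)\<close>.\<close>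
lemma W_free_boundary_condition:
  assumes w: "w \<in> W"
  shows "free_boundary_condition \<Omega> T w"
  unfolding free_boundary_condition_def
proof (safe)
  fix x t assume "(x, t) \<in> free_boundary \<Omega> T w"
  then have fb: "(x, t) \<in> S" "(x, t) \<notin> top_of_set S interior_of (S \<inter> {X. 0 < w X})"
    unfolding free_boundary_def frontier_of_def using closure_of_subset_topspace by fastforce+
  have "openin (top_of_set S) (S \<inter> {X. 0 < w X})"
    using continuous_openin_preimage_gen[OF W_continuous[OF w], of "{0<..}"]
    by (simp add: vimage_def)
  then have "\<not> 0 < w (x, t)"
    using fb by (simp add: interior_of_openin)
  then show w0: "w (x, t) = 0" using W_nonneg[OF w fb(1)] by simp
  have x: "x \<in> \<Omega>" "-T < t" "t \<le> 0" using fb(1) by (auto simp: cylinder_def)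
  obtain e where e: "0 < e" "cball x e \<subseteq> \<Omega>"
    using open_\<Omega> x(1) open_contains_cball by blast
  define K where "K = cball x e \<times> {t}"
  have K: "compact K" "K \<subseteq> S" "(x, t) \<in> K"
    using e x by (auto simp: K_def cylinder_def intro!: compact_Times)
  have bound: "\<bar>w (x + h, t)\<bar> / norm h \<le> \<bar>C K\<bar> * 2 powr (1 + \<alpha> K) * norm h powr \<alpha> K"
    if h: "h \<noteq> 0" "norm h < e" for h
  proof -
    have xh: "(x + h, t) \<in> K" using h by (simp add: K_def dist_norm)
    \<comment> \<open>The factor \<open>2\<close> puts \<open>x + h\<close> into the open ball of the parabolic cylinder around \<open>x\<close>.\<close>
    have "w (x + h, t) \<le> C K * ((2 * norm h) powr (1 + \<alpha> K) + w (x, t))"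
      using h by (intro W_growth[OF w K xh]) (auto simp: parabolic_cylinder_def dist_norm)
    also have "\<dots> \<le> \<bar>C K\<bar> * (2 * norm h) powr (1 + \<alpha> K)"
      unfolding w0 by (intro order_trans[OF _ mult_right_mono[OF abs_ge_self]]) auto
    also have "\<dots> = \<bar>C K\<bar> * 2 powr (1 + \<alpha> K) * norm h powr \<alpha> K * norm h"
      using h by (simp add: powr_mult powr_add)
    finally show ?thesis
      using h W_nonneg[OF w, of "(x + h, t)"] xh K by (simp add: divide_le_eq subset_iff)
  qed
  have "((\<lambda>h. \<bar>C K\<bar> * 2 powr (1 + \<alpha> K) * norm h powr \<alpha> K) \<longlongrightarrow> \<bar>C K\<bar> * 2 powr (1 + \<alpha> K) * 0) (at (0::real^'n))"
    using \<alpha>_pos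
    by (intro tendsto_mult tendsto_const tendsto_zero_powrI[where b="\<alpha> K"] tendsto_norm_zero tendsto_ident_at) auto
  moreover have "\<forall>\<^sub>F h in at 0. norm (\<bar>w (x + h, t)\<bar> / norm h) \<le> \<bar>C K\<bar> * 2 powr (1 + \<alpha> K) * norm h powr \<alpha> K"
    unfolding eventually_at using bound e(1) by (intro exI[of _ e]) auto
  ultimately have "((\<lambda>h. \<bar>w (x + h, t)\<bar> / norm h) \<longlongrightarrow> 0) (at 0)"
    unfolding mult_zero_right by (elim Lim_null_comparison[rotated])
  then show "GDERIV (\<lambda>y. w (y, t)) x :> 0"
    unfolding gderiv_def has_derivative_at using w0 by (simp add: bounded_linear_zero)
qed

end


section \<open>Essential bounds and padded sources\<close>

lemma Linf_AE_bound:
  assumes "f \<in> Linf S"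
  shows "AE X in lebesgue_on S. \<bar>f X\<bar> \<le> Linf_norm S f"
proof -
  have "AE X in lebesgue_on S. ereal \<bar>f X\<bar> \<le> Linf_esssup S f"
    unfolding Linf_esssup_def by (rule esssup_AE)
  moreover have "Linf_esssup S f < \<infinity>" using assms unfolding Linf_def by simp
  ultimately show ?thesis
    unfolding Linf_norm_def by (cases "Linf_esssup S f") (auto elim: eventually_mono)
qed

lemma LinfI:
  assumes "f \<in> borel_measurable (lebesgue_on S)" "AE X in lebesgue_on S. \<bar>f X\<bar> \<le> M"
  shows "f \<in> Linf S" "Linf_esssup S f \<le> ereal M"
proof -
  show *: "Linf_esssup S f \<le> ereal M"
    unfolding Linf_esssup_def using assms by (intro esssup_I) auto
  then have "Linf_esssup S f < \<infinity>" by (rule order.strict_trans1) simp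
  then show "f \<in> Linf S" unfolding Linf_def using assms(1) by simp
qed

lemma Linf_norm_eqI:
  assumes "f \<in> borel_measurable (lebesgue_on S)" "AE X in lebesgue_on S. \<bar>f X\<bar> \<le> M"
    and sharp: "\<And>m. m < M \<Longrightarrow> \<not> (AE X in lebesgue_on S. \<bar>f X\<bar> \<le> m)"
  shows "Linf_norm S f = M"
proof -
  have "Linf_esssup S f = ereal M"
  proof (rule antisym)
    show "ereal M \<le> Linf_esssup S f"
    proof (rule ccontr)
      assume "\<not> ereal M \<le> Linf_esssup S f"
      then obtain m where m: "Linf_esssup S f < ereal m" "m < M"
        by (metis ereal_dense2 ereal_less(2) less_ereal.simps(1) not_le)
      have "AE X in lebesgue_on S. ereal \<bar>f X\<bar> \<le> Linf_esssup S f"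
        unfolding Linf_esssup_def by (rule esssup_AE)
      then have "AE X in lebesgue_on S. \<bar>f X\<bar> \<le> m"
      proof eventually_elim
        case (elim X)
        then have "ereal \<bar>f X\<bar> \<le> ereal m" using m(1) by (meson le_less_trans less_imp_le)
        then show ?case by simp
      qed
      then show False using sharp[OF m(2)] by simp
    qed
  qed (rule LinfI[OF assms(1,2)])
  then show ?thesis unfolding Linf_norm_def by simp
qed

lemma Linf_nonneg_scale:
  assumes "f \<in> Linf_nonneg S" "0 \<le> N"
  shows "(\<lambda>X. N * f X) \<in> Linf_nonneg S"
proof -
  have f: "f \<in> Linf S" "\<And>X. X \<in> S \<Longrightarrow> 0 \<le> f X" using assms(1) by (auto simp: Linf_nonneg_def)
  have [measurable]: "f \<in> borel_measurable (lebesgue_on S)" using f(1) by (simp add: Linf_def)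
  have "AE X in lebesgue_on S. \<bar>N * f X\<bar> \<le> N * Linf_norm S f"
    using Linf_AE_bound[OF f(1)] by (rule eventually_mono) (simp add: abs_mult assms(2) mult_left_mono)
  then have "(\<lambda>X. N * f X) \<in> Linf S" by (intro LinfI(1)) measurable
  then show ?thesis using f(2) assms(2) by (simp add: Linf_nonneg_def)
qed

lemma AE_lebesgue_on_subset:
  assumes "AE X in lebesgue_on S. P X" "K \<subseteq> S" "K \<in> sets lebesgue" "S \<in> sets lebesgue"
  shows "AE X in lebesgue_on K. P X"
proof -
  have "AE X in lebesgue. X \<in> S \<longrightarrow> P X"
    using assms by (subst (asm) AE_restrict_space_iff) auto
  then have "AE X in lebesgue. X \<in> K \<longrightarrow> P X"
    by (rule eventually_mono) (use assms(2) in auto)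
  then show ?thesis using assms by (subst AE_restrict_space_iff) auto
qed

context space_time_cylinder
begin

lemma not_AE_if_open:
  assumes "open U" "U \<noteq> {}" "U \<subseteq> S" "\<And>X. X \<in> U \<Longrightarrow> \<not> P X"
  shows "\<not> (AE X in lebesgue_on S. P X)"
proof
  assume "AE X in lebesgue_on S. P X"
  then have "AE X in lebesgue_on U. P X"
    using assms(1,3) sets_S by (intro AE_lebesgue_on_subset[of _ S U]) auto
  then have "AE X in lebesgue. X \<notin> U"
    using assms(1,4) by (subst (asm) AE_restrict_space_iff) (auto elim: eventually_mono)
  then have "U \<in> null_sets lebesgue"
    using assms(1) by (subst AE_iff_null_sets) auto
  then show False
    using assms(1,2) open_not_negligible negligible_iff_null_sets by blast
qed

text \<open>In the layer \<open>{t < -T + \<delta>}\<close> the source \<open>G\<close> is replaced by a function whose essential supremum is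
  \<open>M\<close>, approached at the initial time, for every \<open>\<tau> \<le> 1\<close>; elsewhere \<open>G\<close> is raised slightly. The
  formula is strictly increasing in \<open>\<tau>\<close> at every point of the cylinder, both inside and outside the
  layer, so that a strictly monotone choice of parameters turns ordered sources into strictly ordered
  ones without changing their norm.\<close>
definition padded :: "real \<Rightarrow> real \<Rightarrow> real \<Rightarrow> 'n field \<Rightarrow> 'n field" where
  "padded M \<delta> \<tau> G X =
     (if snd X + T < \<delta> then M - (1 - \<tau>) * (snd X + T) else G X + \<delta> * \<tau>)"

lemma time_in_S: "X \<in> S \<Longrightarrow> 0 < snd X + T \<and> snd X + T \<le> T"
  by (auto simp: cylinder_def)

lemma measurable_padded:
  assumes [measurable]: "G \<in> borel_measurable (lebesgue_on S)"
  shows "padded M \<delta> \<tau> G \<in> borel_measurable (lebesgue_on S)"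
proof -
  have [measurable]: "(\<lambda>X. snd X :: real) \<in> borel_measurable (lebesgue_on S)"
    by (intro continuous_imp_measurable_on_sets_lebesgue sets_S continuous_intros)
  show ?thesis unfolding padded_def by measurable
qed

text \<open>The norm is exactly \<open>M\<close>: close enough to the initial time the padded source exceeds any \<open>m < M\<close> on
  a nonempty open set. Positivity serves the comparison with the solution for zero source.\<close>
lemma padded_Linf:
  assumes G: "G \<in> Linf_nonneg S" "AE X in lebesgue_on S. \<bar>G X\<bar> \<le> M - 1" and "1 \<le> M"
    and \<delta>: "0 < \<delta>" "\<delta> \<le> 1" and \<tau>: "0 \<le> \<tau>" "\<tau> \<le> 1"
  shows "padded M \<delta> \<tau> G \<in> Linf_nonneg S" "Linf_norm S (padded M \<delta> \<tau> G) = M"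
    "0 < \<tau> \<Longrightarrow> X \<in> S \<Longrightarrow> 0 < padded M \<delta> \<tau> G X"
proof -
  have meas: "padded M \<delta> \<tau> G \<in> borel_measurable (lebesgue_on S)"
    using G(1) by (intro measurable_padded) (simp add: Linf_nonneg_def Linf_def)
  have G0: "0 \<le> G X" if "X \<in> S" for X using G(1) that by (simp add: Linf_nonneg_def)
  have bottom: "0 < M - (1 - \<tau>) * (snd X + T)" "M - (1 - \<tau>) * (snd X + T) \<le> M"
      "M - (snd X + T) \<le> M - (1 - \<tau>) * (snd X + T)"
    if "X \<in> S" "snd X + T < \<delta>" for X
  proof -
    have "(1 - \<tau>) * (snd X + T) \<le> 1 * (snd X + T)"
      using \<tau> time_in_S[OF that(1)] by (intro mult_right_mono) auto
    moreover have "0 \<le> (1 - \<tau>) * (snd X + T)"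
      using \<tau> time_in_S[OF that(1)] by simp
    moreover have "snd X + T < M" using that \<delta> \<open>1 \<le> M\<close> by linarith
    ultimately show "0 < M - (1 - \<tau>) * (snd X + T)" "M - (1 - \<tau>) * (snd X + T) \<le> M"
      "M - (snd X + T) \<le> M - (1 - \<tau>) * (snd X + T)"
      by auto
  qed
  have \<delta>\<tau>: "0 \<le> \<delta> * \<tau>" "\<delta> * \<tau> \<le> 1" using \<delta> \<tau> by (auto intro: mult_le_one)
  have nonneg: "0 \<le> padded M \<delta> \<tau> G X" if "X \<in> S" for X
    using bottom(1)[OF that] G0[OF that] \<delta>\<tau> unfolding padded_def by (auto intro: less_imp_le)
  have "AE X in lebesgue_on S. X \<in> S"
    using sets_S by (subst AE_restrict_space_iff) auto
  with G(2) have bound: "AE X in lebesgue_on S. \<bar>padded M \<delta> \<tau> G X\<bar> \<le> M"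
  proof eventually_elim
    case (elim X)
    then show ?case
      using nonneg[of X] bottom(2)[of X] \<delta>\<tau> unfolding padded_def by (auto simp: abs_le_iff)
  qed
  show "padded M \<delta> \<tau> G \<in> Linf_nonneg S"
    unfolding Linf_nonneg_def using LinfI(1)[OF meas bound] nonneg by simp
  show "Linf_norm S (padded M \<delta> \<tau> G) = M"
  proof (rule Linf_norm_eqI[OF meas bound])
    fix m assume m: "m < M"
    \<comment> \<open>On the slab of height \<open>\<eta>\<close> above the initial time the padded source is larger than \<open>M - \<eta> \<ge> m\<close>.\<close>
    define \<eta> where "\<eta> = min T (min \<delta> (M - m))"
    have \<eta>: "0 < \<eta>" "\<eta> \<le> T" "\<eta> \<le> \<delta>" "\<eta> \<le> M - m" using T_pos \<delta> m by (auto simp: \<eta>_def)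
    define U where "U = \<Omega> \<times> {-T<..<-T+\<eta>}"
    have US: "U \<subseteq> S" using \<eta> by (auto simp: U_def cylinder_def)
    show "\<not> (AE X in lebesgue_on S. \<bar>padded M \<delta> \<tau> G X\<bar> \<le> m)"
    proof (rule not_AE_if_open)
      show "open U" unfolding U_def using open_\<Omega> by (intro open_Times) auto
      show "U \<noteq> {}" unfolding U_def using \<Omega>_nonempty \<eta>(1) by auto
      show "U \<subseteq> S" by (rule US)
      show "\<not> \<bar>padded M \<delta> \<tau> G X\<bar> \<le> m" if "X \<in> U" for X
      proof -
        have X: "X \<in> S" "snd X + T < \<eta>" using that US by (auto simp: U_def)
        then show ?thesis using bottom(3)[OF X(1)] \<eta> unfolding padded_def by auto
      qed
    qed
  qed
  show "0 < padded M \<delta> \<tau> G X" if "0 < \<tau>" "X \<in> S"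
    using bottom(1)[OF that(2)] G0[OF that(2)] \<delta> that unfolding padded_def
    by (auto intro: add_nonneg_pos)
qed

lemma padded_strict_mono:
  assumes "\<tau> < \<tau>'" "0 < \<delta>" "G X \<le> G' X" "X \<in> S"
  shows "padded M \<delta> \<tau> G X < padded M \<delta> \<tau>' G' X"
proof -
  have "(1 - \<tau>') * (snd X + T) < (1 - \<tau>) * (snd X + T)"
    using assms time_in_S by (intro mult_strict_right_mono) auto
  moreover have "\<delta> * \<tau> < \<delta> * \<tau>'" using assms by simp
  ultimately show ?thesis using assms(3) unfolding padded_def by auto
qed

lemma AE_in_compact: "compact K \<Longrightarrow> AE X in lebesgue_on K. X \<in> K"
  by (subst AE_restrict_space_iff) (auto dest: fmeasurableD[OF lmeasurable_compact])

text \<open>Two ways of removing the padding: the parameter \<open>\<tau>\<close> converges along the monotone iteration with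
  the layer kept, and afterwards the layer shrinks.\<close>
lemma padded_limit_parameter:
  assumes G: "Linf_loc_limit S Gs G" and \<tau>: "\<tau>s \<longlonglongrightarrow> \<tau>" and "0 < \<delta>"
  shows "Linf_loc_limit S (\<lambda>j. padded M \<delta> (\<tau>s j) (Gs j)) (padded M \<delta> \<tau> G)"
  unfolding Linf_loc_limit_def
proof (intro allI impI)
  fix K and e :: real assume K: "compact K \<and> K \<subseteq> S" and e: "0 < e"
  have "(\<lambda>j. (T + \<delta>) * \<bar>\<tau>s j - \<tau>\<bar>) \<longlonglongrightarrow> (T + \<delta>) * \<bar>\<tau> - \<tau>\<bar>"
    by (intro tendsto_intros \<tau>)
  then have "\<forall>\<^sub>F j in sequentially. (T + \<delta>) * \<bar>\<tau>s j - \<tau>\<bar> < e / 2"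
    by (rule order_tendstoD) (use e in simp)
  moreover have "\<forall>\<^sub>F j in sequentially. AE X in lebesgue_on K. \<bar>Gs j X - G X\<bar> < e / 2"
    using G K half_gt_zero[OF e] unfolding Linf_loc_limit_def by blast
  ultimately show "\<forall>\<^sub>F j in sequentially. AE X in lebesgue_on K.
      \<bar>padded M \<delta> (\<tau>s j) (Gs j) X - padded M \<delta> \<tau> G X\<bar> < e"
  proof eventually_elim
    case (elim j)
    from elim(2) AE_in_compact[OF conjunct1[OF K]] show ?case
    proof eventually_elim
      case (elim X)
      then have p: "0 \<le> snd X + T" "snd X + T \<le> T" using time_in_S[of X] K by auto
      have "\<bar>\<tau>s j - \<tau>\<bar> * (snd X + T) \<le> \<bar>\<tau>s j - \<tau>\<bar> * (T + \<delta>)"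
        using p \<open>0 < \<delta>\<close> by (intro mult_left_mono) auto
      moreover have "(M - (1 - \<tau>s j) * (snd X + T)) - (M - (1 - \<tau>) * (snd X + T)) = (\<tau>s j - \<tau>) * (snd X + T)"
        by (simp add: algebra_simps)
      then have "\<bar>(M - (1 - \<tau>s j) * (snd X + T)) - (M - (1 - \<tau>) * (snd X + T))\<bar> = \<bar>\<tau>s j - \<tau>\<bar> * (snd X + T)"
        using p by (simp add: abs_mult)
      moreover have "\<bar>\<tau>s j - \<tau>\<bar> * \<delta> \<le> \<bar>\<tau>s j - \<tau>\<bar> * (T + \<delta>)"
        using T_pos by (intro mult_left_mono) auto
      moreover have "\<bar>(Gs j X + \<delta> * \<tau>s j) - (G X + \<delta> * \<tau>)\<bar> \<le> \<bar>Gs j X - G X\<bar> + \<bar>\<tau>s j - \<tau>\<bar> * \<delta>"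
      proof -
        have "(Gs j X + \<delta> * \<tau>s j) - (G X + \<delta> * \<tau>) = (Gs j X - G X) + (\<tau>s j - \<tau>) * \<delta>"
          by (simp add: algebra_simps)
        then show ?thesis
          using abs_triangle_ineq[of "Gs j X - G X" "(\<tau>s j - \<tau>) * \<delta>"] \<open>0 < \<delta>\<close> by (simp add: abs_mult)
      qed
      ultimately show ?case
        using elim \<open>(T + \<delta>) * \<bar>\<tau>s j - \<tau>\<bar> < e / 2\<close> e unfolding padded_def
        by (simp add: mult.commute)
    qed
  qed
qed

lemma padded_limit_layer:
  assumes G: "Linf_loc_limit S Gs G" and \<delta>: "\<delta>s \<longlonglongrightarrow> 0"
  shows "Linf_loc_limit S (\<lambda>j. padded M (\<delta>s j) \<tau> (Gs j)) G"
  unfolding Linf_loc_limit_def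
proof (intro allI impI)
  fix K and e :: real assume K: "compact K \<and> K \<subseteq> S" and e: "0 < e"
  obtain \<eta> where \<eta>: "0 < \<eta>" "\<And>X. X \<in> K \<Longrightarrow> \<eta> \<le> snd X + T"
    using compact_above_bottom[OF conjunct1[OF K] conjunct2[OF K]] by blast
  have "(\<lambda>j. \<bar>\<delta>s j * \<tau>\<bar>) \<longlonglongrightarrow> \<bar>0 * \<tau>\<bar>" by (intro tendsto_intros \<delta>)
  then have "\<forall>\<^sub>F j in sequentially. \<bar>\<delta>s j * \<tau>\<bar> < e / 2"
    by (rule order_tendstoD) (use e in simp)
  moreover have "\<forall>\<^sub>F j in sequentially. \<delta>s j < \<eta>"
    using \<delta> \<eta>(1) by (rule order_tendstoD)
  moreover have "\<forall>\<^sub>F j in sequentially. AE X in lebesgue_on K. \<bar>Gs j X - G X\<bar> < e / 2"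
    using G K half_gt_zero[OF e] unfolding Linf_loc_limit_def by blast
  ultimately show "\<forall>\<^sub>F j in sequentially. AE X in lebesgue_on K.
      \<bar>padded M (\<delta>s j) \<tau> (Gs j) X - G X\<bar> < e"
  proof eventually_elim
    case (elim j)
    note \<delta>j = elim(1,2)
    from elim(3) AE_in_compact[OF conjunct1[OF K]] show ?case
    proof eventually_elim
      case (elim X)
      have "padded M (\<delta>s j) \<tau> (Gs j) X = Gs j X + \<delta>s j * \<tau>"
        using \<eta>(2)[OF elim(2)] \<delta>j(2) unfolding padded_def by simp
      then show ?case using elim(1) \<delta>j(1) by linarith
    qed
  qed
qed

lemma coupled_source_Linf:
  assumes f: "f \<in> Linf_nonneg S" and k: "k \<in> class_K"
    and v: "continuous_on S v" "\<And>X. X \<in> S \<Longrightarrow> v X \<le> B"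
  shows "(\<lambda>X. f X * k (v X)) \<in> Linf_nonneg S"
    "AE X in lebesgue_on S. \<bar>f X * k (v X)\<bar> \<le> Linf_norm S f * k B"
proof -
  have k: "\<And>t. 0 \<le> k t" "mono k" "continuous_on UNIV k" using k by (auto simp: class_K_def)
  have f': "f \<in> Linf S" "\<And>X. X \<in> S \<Longrightarrow> 0 \<le> f X" using f by (auto simp: Linf_nonneg_def)
  have [measurable]: "f \<in> borel_measurable (lebesgue_on S)" using f' by (simp add: Linf_def)
  have "continuous_on S (\<lambda>X. k (v X))"
    using continuous_on_compose2[OF k(3) v(1)] by simp
  then have [measurable]: "(\<lambda>X. k (v X)) \<in> borel_measurable (lebesgue_on S)"
    by (intro continuous_imp_measurable_on_sets_lebesgue sets_S)
  have "AE X in lebesgue_on S. X \<in> S"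
    using sets_S by (subst AE_restrict_space_iff) auto
  with Linf_AE_bound[OF f'(1)]
  show bound: "AE X in lebesgue_on S. \<bar>f X * k (v X)\<bar> \<le> Linf_norm S f * k B"
  proof eventually_elim
    case (elim X)
    then show ?case
      using k(1) monoD[OF k(2) v(2)] unfolding abs_mult by (intro mult_mono) (auto intro: order_trans[OF abs_ge_zero])
  qed
  have "(\<lambda>X. f X * k (v X)) \<in> Linf S" by (rule LinfI(1)[OF _ bound]) measurable
  then show "(\<lambda>X. f X * k (v X)) \<in> Linf_nonneg S"
    using f'(2) k(1) by (simp add: Linf_nonneg_def)
qed

text \<open>All arguments of \<open>k\<close> lie in the compact interval \<open>[0, B]\<close>, where \<open>k\<close> is uniformly continuous.\<close>
lemma coupled_source_limit:
  assumes f: "f \<in> Linf_nonneg S" and k: "k \<in> class_K" and lim: "locally_uniform_limit S vs v"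
    and vs: "\<And>j X. X \<in> S \<Longrightarrow> 0 \<le> vs j X \<and> vs j X \<le> B"
    and v: "\<And>X. X \<in> S \<Longrightarrow> 0 \<le> v X \<and> v X \<le> B"
  shows "Linf_loc_limit S (\<lambda>j X. f X * k (vs j X)) (\<lambda>X. f X * k (v X))"
  unfolding Linf_loc_limit_def
proof (intro allI impI)
  fix K and e :: real assume K: "compact K \<and> K \<subseteq> S" and e: "0 < e"
  have f': "f \<in> Linf S" using f by (auto simp: Linf_nonneg_def)
  have "continuous_on {0..B} k" using k continuous_on_subset by (auto simp: class_K_def)
  then have "uniformly_continuous_on {0..B} k" by (rule compact_uniformly_continuous) simp
  moreover define F where "F = \<bar>Linf_norm S f\<bar> + 1"
  have F: "0 < F" by (simp add: F_def)
  moreover have "0 < e / F" using e F by simp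
  ultimately obtain d where d: "0 < d"
    "\<forall>s\<in>{0..B}. \<forall>t\<in>{0..B}. dist t s < d \<longrightarrow> dist (k t) (k s) < e / F"
    unfolding uniformly_continuous_on_def by blast
  have "AE X in lebesgue_on K. \<bar>f X\<bar> \<le> Linf_norm S f"
    using Linf_AE_bound[OF f'] K sets_S by (intro AE_lebesgue_on_subset[of _ S K]) (auto dest: fmeasurableD[OF lmeasurable_compact])
  with AE_in_compact[OF conjunct1[OF K]]
  have bound: "AE X in lebesgue_on K. X \<in> K \<and> \<bar>f X\<bar> < F"
    by eventually_elim (auto simp: F_def)
  have "\<forall>\<^sub>F j in sequentially. \<forall>X\<in>K. dist (vs j X) (v X) < d"
    using lim K d(1) unfolding locally_uniform_limit_def uniform_limit_iff by blast
  then show "\<forall>\<^sub>F j in sequentially. AE X in lebesgue_on K. \<bar>f X * k (vs j X) - f X * k (v X)\<bar> < e"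
  proof eventually_elim
    case (elim j)
    note j = elim
    from bound show ?case
    proof eventually_elim
      case (elim X)
      then have X: "X \<in> K" "X \<in> S" using K by auto
      have "\<bar>k (vs j X) - k (v X)\<bar> < e / F"
        using d(2) vs[OF X(2)] v[OF X(2)] bspec[OF j X(1)] by (auto simp: dist_real_def)
      then have "\<bar>f X\<bar> * \<bar>k (vs j X) - k (v X)\<bar> < F * (e / F)"
        using elim by (intro mult_strict_mono') auto
      then show ?case using F by (simp add: abs_mult[symmetric] right_diff_distrib)
    qed
  qed
qed

end


lemma locally_uniform_subsequence:
  assumes "locally_uniform_limit A hs h" "strict_mono r"
  shows "locally_uniform_limit A (\<lambda>j. hs (r j)) h"
  using assms eventually_subseq unfolding locally_uniform_limit_def uniform_limit_iff by blast


section \<open>A single equation\<close>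

locale singular_equation = space_time_cylinder \<Omega> T for \<Omega> :: "(real ^ 'n) set" and T +
  fixes sol :: "'n solution_notion" and L :: "'n operator" and \<F> :: "'n field set"
    and a C0 M0 :: real and g :: "'n field"
  assumes operator_on: "operator_on \<Omega> T sol L \<F>"
    and solvability: "solvability \<Omega> T a C0 sol L \<F>"
    and comparison: "comparison \<Omega> T a C0 sol L \<F>"
    and convergence: "convergence \<Omega> T M0 a C0 sol L \<F>"
    and g: "g \<in> cont_nonneg (parabolic_boundary \<Omega> T)"
begin

lemma \<F>_continuous: "w \<in> \<F> \<Longrightarrow> continuous_on S w"
  and \<F>_nonneg: "w \<in> \<F> \<Longrightarrow> X \<in> S \<Longrightarrow> 0 \<le> w X"
  using operator_on unfolding operator_on_def cont_nonneg_def by auto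

lemma sol_on_positivity_set:
  assumes "w \<in> \<F>" "sol L S w F"
  shows "sol L (S \<inter> {X. 0 < w X}) w F"
proof -
  have "openin (top_of_set S) (S \<inter> {X. 0 < w X})"
    using continuous_openin_preimage_gen[OF \<F>_continuous[OF assms(1)], of "{0<..}"]
    by (simp add: vimage_def)
  moreover have "openin (top_of_set S) S" by simp
  ultimately show ?thesis
    using operator_on assms unfolding operator_on_def by (meson inf_le1)
qed

lemma compare:
  assumes "f \<in> Linf_nonneg S" "f' \<in> Linf_nonneg S" "h \<in> class_H_tilde a C0" "w \<in> \<F>" "w' \<in> \<F>"
    and "sol L S w (\<lambda>X. f X * h (w X))" "boundary_values \<Omega> T w g"
    and "sol L S w' (\<lambda>X. f' X * h (w' X))" "boundary_values \<Omega> T w' g"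
    and "\<And>X. X \<in> S \<Longrightarrow> f X < f' X" "X \<in> S"
  shows "w' X \<le> w X"
  using comparison[unfolded comparison_def, rule_format, OF g, of f f' h w w'] assms by blast

lemma zero_Linf: "(\<lambda>_. 0) \<in> Linf_nonneg S"
  unfolding Linf_nonneg_def using LinfI(1)[of "\<lambda>_. 0" S 0] by simp

text \<open>Solvability for the fixed boundary data \<open>g\<close>: the constants depend on the source only through its
  norm. The solution itself stands in for the upper barrier, which Solvability does not supply.\<close>
lemma solution_with_estimates:
  obtains \<alpha> :: "real \<Rightarrow> 'n point set \<Rightarrow> real" and \<rho> :: "real \<Rightarrow> 'n point set \<Rightarrow> real \<Rightarrow> real"
    and lo and C :: "real \<Rightarrow> 'n point set \<Rightarrow> real"
  where "\<And>M K. 0 < \<alpha> M K" "\<And>M K. modulus_of_continuity (\<rho> M K)"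
    "\<And>f h. f \<in> Linf_nonneg S \<Longrightarrow> h \<in> class_H_tilde a C0 \<Longrightarrow> boundary_values \<Omega> T (lo (Linf_norm S f)) g"
    "\<And>f h. f \<in> Linf_nonneg S \<Longrightarrow> h \<in> class_H_tilde a C0 \<Longrightarrow>
       \<exists>w\<in>\<F>. sol L S w (\<lambda>X. f X * h (w X)) \<and> boundary_values \<Omega> T w g \<and>
         w \<in> apriori_class S (\<rho> (Linf_norm S f)) (C (Linf_norm S f)) (\<alpha> (Linf_norm S f)) (lo (Linf_norm S f)) w"
proof -
  define N where "N = sup_norm (parabolic_boundary \<Omega> T) g"
  obtain C \<alpha> :: "'n point set \<Rightarrow> real \<Rightarrow> real \<Rightarrow> real" and \<rho> lo where const:
      "\<forall>K M N. 0 < C K M N \<and> 0 < \<alpha> K M N \<and> \<alpha> K M N < 1 \<and> modulus_of_continuity (\<rho> K M N)"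
    and solv: "\<forall>g\<in>cont_nonneg (parabolic_boundary \<Omega> T). \<forall>f\<in>Linf_nonneg S. \<forall>h\<in>class_H_tilde a C0.
      let M = Linf_norm S f; N = sup_norm (parabolic_boundary \<Omega> T) g
      in boundary_values \<Omega> T (lo M g) g \<and>
        (\<exists>w\<in>\<F>. sol L S w (\<lambda>X. f X * h (w X)) \<and> boundary_values \<Omega> T w g \<and>
           (\<forall>X\<in>S. lo M g X \<le> w X) \<and>
           (\<forall>K. compactly_contained K S \<longrightarrow>
              (\<forall>X1\<in>K. \<forall>X2\<in>K. \<bar>w X1 - w X2\<bar> \<le> \<rho> K M N (parabolic_dist X1 X2)) \<and>
              (\<forall>Z\<in>K. \<forall>r>0. (SUP X\<in>parabolic_cylinder r Z \<inter> K. w X)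
                  \<le> C K M N * (r powr (1 + \<alpha> K M N) + w Z))))"
    using solvability unfolding solvability_def by (elim exE conjE) (rule that)
  have g_solv: "boundary_values \<Omega> T (lo (Linf_norm S f) g) g" (is ?lo)
      "\<exists>w\<in>\<F>. sol L S w (\<lambda>X. f X * h (w X)) \<and> boundary_values \<Omega> T w g \<and>
         w \<in> apriori_class S (\<lambda>K. \<rho> K (Linf_norm S f) N) (\<lambda>K. C K (Linf_norm S f) N)
           (\<lambda>K. \<alpha> K (Linf_norm S f) N) (lo (Linf_norm S f) g) w" (is ?w)
    if f: "f \<in> Linf_nonneg S" and h: "h \<in> class_H_tilde a C0" for f h
  proof -
    define M where "M = Linf_norm S f"
    note solv' = bspec[OF bspec[OF bspec[OF solv g] f] h, unfolded Let_def, folded M_def N_def]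
    show ?lo using solv' unfolding M_def by (rule conjunct1)
    obtain w where w: "w \<in> \<F>" "sol L S w (\<lambda>X. f X * h (w X))" "boundary_values \<Omega> T w g"
      and lo: "\<forall>X\<in>S. lo M g X \<le> w X"
      and est: "\<forall>K. compactly_contained K S \<longrightarrow>
              (\<forall>X1\<in>K. \<forall>X2\<in>K. \<bar>w X1 - w X2\<bar> \<le> \<rho> K M N (parabolic_dist X1 X2)) \<and>
              (\<forall>Z\<in>K. \<forall>r>0. (SUP X\<in>parabolic_cylinder r Z \<inter> K. w X)
                  \<le> C K M N * (r powr (1 + \<alpha> K M N) + w Z))"
      using conjunct2[OF solv'] by (elim bexE conjE) (rule that)
    have cc: "compactly_contained K S" if "compact K \<and> K \<subseteq> S" for K
      using that by (simp add: compactly_contained_def compact_imp_closed)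
    have "w \<in> apriori_class S (\<lambda>K. \<rho> K M N) (\<lambda>K. C K M N) (\<lambda>K. \<alpha> K M N) (lo M g) w"
      unfolding apriori_class_def
    proof (intro CollectI conjI ballI allI impI)
      fix K and Z X :: "'n point" and r :: real
      assume K: "compact K \<and> K \<subseteq> S" and Z: "Z \<in> K" "0 < r" and X: "X \<in> parabolic_cylinder r Z \<inter> K"
      have "compact (w ` K)"
        using K \<F>_continuous[OF w(1)] by (intro compact_continuous_image) (auto intro: continuous_on_subset)
      then have "bdd_above (w ` K)"
        by (intro bounded_imp_bdd_above compact_imp_bounded)
      then have "bdd_above (w ` (parabolic_cylinder r Z \<inter> K))"
        by (rule bdd_above_mono) auto
      then have "w X \<le> (SUP X\<in>parabolic_cylinder r Z \<inter> K. w X)"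
        using X by (rule cSUP_upper[rotated])
      also have "\<dots> \<le> C K M N * (r powr (1 + \<alpha> K M N) + w Z)"
        using est cc[OF K] Z by blast
      finally show "w X \<le> C K M N * (r powr (1 + \<alpha> K M N) + w Z)" .
    next
      fix K X Y assume "compact K \<and> K \<subseteq> S" "X \<in> K" "Y \<in> K"
      then show "\<bar>w X - w Y\<bar> \<le> \<rho> K M N (parabolic_dist X Y)"
        using est cc by blast
    qed (use lo \<F>_nonneg[OF w(1)] in auto)
    then show ?w using w unfolding M_def by blast
  qed
  show thesis
  proof (rule that[of "\<lambda>M K. \<alpha> K M N" "\<lambda>M K. \<rho> K M N" "\<lambda>M. lo M g" "\<lambda>M K. C K M N"])
    show "0 < \<alpha> K M N" "modulus_of_continuity (\<rho> K M N)" for M K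
      using const by blast+
  qed (rule g_solv; assumption)+
qed

text \<open>The barrier is required for all nonlinearities at once, because the Lipschitz approximations vary
  during the construction.\<close>
definition upper_barrier :: "'n field \<Rightarrow> bool" where
  "upper_barrier U \<longleftrightarrow> boundary_values \<Omega> T U g \<and> bounded (U ` S) \<and>
     (\<forall>f\<in>Linf_nonneg S. \<forall>h\<in>class_H_tilde a C0. \<forall>w\<in>\<F>.
        sol L S w (\<lambda>X. f X * h (w X)) \<longrightarrow> boundary_values \<Omega> T w g \<longrightarrow>
        (\<forall>X\<in>S. 0 < f X) \<longrightarrow> (\<forall>X\<in>S. w X \<le> U X))"

text \<open>With source \<open>0\<close> the right-hand side vanishes for every nonlinearity, so one and the same function
  solves all the equations with zero source and can be compared with every solution with positive source.\<close>
lemma ex_upper_barrier: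
  assumes h: "h \<in> class_H_tilde a C0"
  shows "\<exists>U. upper_barrier U"
proof -
  obtain U where U: "U \<in> \<F>" "sol L S U (\<lambda>X. 0 * h (U X))" "boundary_values \<Omega> T U g"
  proof (rule solution_with_estimates)
    fix \<alpha> C :: "real \<Rightarrow> 'n point set \<Rightarrow> real" and \<rho> lo
    assume "\<And>f h. f \<in> Linf_nonneg S \<Longrightarrow> h \<in> class_H_tilde a C0 \<Longrightarrow>
       \<exists>w\<in>\<F>. sol L S w (\<lambda>X. f X * h (w X)) \<and> boundary_values \<Omega> T w g \<and>
         w \<in> apriori_class S (\<rho> (Linf_norm S f)) (C (Linf_norm S f)) (\<alpha> (Linf_norm S f)) (lo (Linf_norm S f)) w"
    from this[OF zero_Linf h] show thesis
      by (elim bexE conjE) (rule that)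
  qed
  have "w X \<le> U X"
    if *: "f \<in> Linf_nonneg S" "h' \<in> class_H_tilde a C0" "w \<in> \<F>"
      "sol L S w (\<lambda>X. f X * h' (w X))" "boundary_values \<Omega> T w g"
      "\<forall>X\<in>S. 0 < f X" "X \<in> S" for f h' w X
  proof -
    have "sol L S U (\<lambda>X. 0 * h' (U X))" using U(2) by simp
    then show ?thesis
      by (rule compare[OF zero_Linf *(1,2) U(1) *(3) _ U(3) *(4,5)]) (use * in auto)
  qed
  moreover have "bounded (U ` S)"
    using \<F>_continuous[OF U(1)] U(3) by (rule bounded_if_boundary_values)
  ultimately show ?thesis unfolding upper_barrier_def using U(3) by blast
qed

end

text \<open>An equation together with constants that work for all positive sources of norm exactly \<open>M\<close>.\<close>
locale controlled_equation =
  singular_equation \<Omega> T sol L \<F> a C0 M0 g + apriori_estimates \<Omega> T \<rho> C \<alpha> lo up g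
  for \<Omega> :: "(real ^ 'n) set" and T sol L \<F> a C0 M0 g \<rho> C \<alpha> lo up +
  fixes M :: real
  assumes M_ge_1: "1 \<le> M" and bounded_up: "bounded (up ` S)"
    and solve: "f \<in> Linf_nonneg S \<Longrightarrow> Linf_norm S f = M \<Longrightarrow> (\<And>X. X \<in> S \<Longrightarrow> 0 < f X) \<Longrightarrow>
      h \<in> class_H_tilde a C0 \<Longrightarrow> \<exists>w\<in>\<F>. w \<in> W \<and> sol L S w (\<lambda>X. f X * h (w X))"
begin

text \<open>Convergence gives the equation for the limit but not its boundary values; these come from
  membership in the class of functions with a priori estimates.\<close>
lemma limit_solution:
  assumes ws: "\<And>j::nat. ws j \<in> \<F>" "\<And>j. ws j \<in> W"
    and lim: "\<And>X. X \<in> S \<Longrightarrow> (\<lambda>j. ws j X) \<longlonglongrightarrow> w X"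
    and hs: "\<And>j. hs j \<in> class_H_tilde a C0"
    and fs: "\<And>j. fs j \<in> Linf_nonneg S" "\<And>j. Linf_norm S (fs j) = M"
    and eq: "\<And>j. sol L (S \<inter> {X. 0 < ws j X}) (ws j) (\<lambda>X. fs j X * hs j (ws j X))"
    and f: "f \<in> Linf S" "Linf_loc_limit S fs f"
    and h: "h \<in> class_H M0 \<union> class_H_tilde a C0" "locally_uniform_limit {0<..} hs h"
  shows "w \<in> \<F> \<and> sol L (S \<inter> {X. 0 < w X}) w (\<lambda>X. f X * h (w X))"
proof -
  have w: "w \<in> W" using ws(2) lim by (rule W_closed)
  have "bdd_above (range (\<lambda>j. Linf_norm S (fs j)))" using fs(2) by simp
  then show ?thesis
    using ws hs fs eq W_boundary_values[OF ws(2)]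
    by (intro convergence[unfolded convergence_def, rule_format, OF g, of ws hs fs f w h]
        W_cont_nonneg w W_locally_uniform[OF ws(2) lim] f h) auto
qed

end

context singular_equation
begin

text \<open>Fixing the norm of the source fixes the constants of Solvability; the upper barrier completes them.\<close>
lemma controlled_equation:
  assumes h: "h \<in> class_H_tilde a C0" and "1 \<le> M"
    and up: "upper_barrier up"
  obtains \<rho> C \<alpha> lo where "controlled_equation \<Omega> T sol L \<F> a C0 M0 g \<rho> C \<alpha> lo up M"
proof -
  obtain \<alpha> :: "real \<Rightarrow> 'n point set \<Rightarrow> real" and \<rho> :: "real \<Rightarrow> 'n point set \<Rightarrow> real \<Rightarrow> real"
    and lo and C :: "real \<Rightarrow> 'n point set \<Rightarrow> real"
    where const: "\<And>M K. 0 < \<alpha> M K" "\<And>M K. modulus_of_continuity (\<rho> M K)"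
    and lo: "\<And>f h. f \<in> Linf_nonneg S \<Longrightarrow> h \<in> class_H_tilde a C0 \<Longrightarrow> boundary_values \<Omega> T (lo (Linf_norm S f)) g"
    and solv: "\<And>f h. f \<in> Linf_nonneg S \<Longrightarrow> h \<in> class_H_tilde a C0 \<Longrightarrow>
       \<exists>w\<in>\<F>. sol L S w (\<lambda>X. f X * h (w X)) \<and> boundary_values \<Omega> T w g \<and>
         w \<in> apriori_class S (\<rho> (Linf_norm S f)) (C (Linf_norm S f)) (\<alpha> (Linf_norm S f)) (lo (Linf_norm S f)) w"
    by (rule solution_with_estimates) (rule that; assumption)
  \<comment> \<open>The lower barrier is known to attain the boundary values once some source has norm \<open>M\<close>.\<close>
  have "AE X in lebesgue_on S. \<bar>0\<bar> \<le> M - 1" using \<open>1 \<le> M\<close> by simp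
  note const_source = padded_Linf(1,2)[OF zero_Linf this \<open>1 \<le> M\<close>, of 1 1, simplified]
  have lo_M: "boundary_values \<Omega> T (lo M) g"
    using lo[OF const_source(1) h] const_source(2) by simp
  have "apriori_estimates \<Omega> T (\<rho> M) (\<alpha> M) (lo M) up g"
    by unfold_locales (use const lo_M up in \<open>auto simp: upper_barrier_def\<close>)
  moreover have "\<exists>w\<in>\<F>. w \<in> apriori_class S (\<rho> M) (C M) (\<alpha> M) (lo M) up \<and> sol L S w (\<lambda>X. f X * h (w X))"
    if f: "f \<in> Linf_nonneg S" "Linf_norm S f = M" "\<And>X. X \<in> S \<Longrightarrow> 0 < f X"
      and h: "h \<in> class_H_tilde a C0" for f h
  proof -
    obtain w where w: "w \<in> \<F>" "sol L S w (\<lambda>X. f X * h (w X))" "boundary_values \<Omega> T w g"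
      and est: "w \<in> apriori_class S (\<rho> M) (C M) (\<alpha> M) (lo M) w"
      using solv[OF f(1) h] unfolding f(2) by blast
    have "w X \<le> up X" if "X \<in> S" for X
      using up f(1,3) h w that unfolding upper_barrier_def by blast
    then have "w \<in> apriori_class S (\<rho> M) (C M) (\<alpha> M) (lo M) up"
      using est by (rule apriori_class_change_barrier)
    then show ?thesis using w by blast
  qed
  ultimately have "controlled_equation \<Omega> T sol L \<F> a C0 M0 g (\<rho> M) (C M) (\<alpha> M) (lo M) up M"
    using \<open>1 \<le> M\<close> up singular_equation_axioms unfolding upper_barrier_def
    by (intro controlled_equation.intro controlled_equation_axioms.intro) auto
  then show thesis by (rule that)
qed

end


section \<open>The coupled system\<close>

text \<open>The constant \<open>B\<close> bounds all functions that occur, and \<open>M\<close> exceeds all unpadded sources by at least \<open>1\<close>, which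
  leaves room for the term \<open>\<delta> * \<tau>\<close> of the padding.\<close>
locale coupled_system =
  E1: controlled_equation \<Omega> T sol1 L1 \<F>1 a1 C01 M0 g1 \<rho>1 C1 \<alpha>1 lo1 up1 M +
  E2: controlled_equation \<Omega> T sol2 L2 \<F>2 a2 C02 M0 g2 \<rho>2 C2 \<alpha>2 lo2 up2 M
  for \<Omega> :: "(real ^ 'n) set" and T M0 M sol1 L1 \<F>1 a1 C01 g1 \<rho>1 C1 \<alpha>1 lo1 up1
    sol2 L2 \<F>2 a2 C02 g2 \<rho>2 C2 \<alpha>2 lo2 up2 +
  fixes f1 f2 :: "'n field" and k1 k2 :: "real \<Rightarrow> real" and B :: real
  assumes f1: "f1 \<in> Linf_nonneg (cylinder \<Omega> T)" and f2: "f2 \<in> Linf_nonneg (cylinder \<Omega> T)"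
    and k1: "k1 \<in> class_K" and k2: "k2 \<in> class_K"
    and B: "0 \<le> B" and up1: "\<And>X. X \<in> cylinder \<Omega> T \<Longrightarrow> up1 X \<le> B"
    and up2: "\<And>X. X \<in> cylinder \<Omega> T \<Longrightarrow> up2 X \<le> B"
    and M1: "Linf_norm (cylinder \<Omega> T) f1 * k1 B \<le> M - 1"
    and M2: "Linf_norm (cylinder \<Omega> T) f2 * k2 B \<le> M - 1"
begin

abbreviation S :: "'n point set" where "S \<equiv> cylinder \<Omega> T"
abbreviation padded where "padded \<equiv> space_time_cylinder.padded T M"

text \<open>The functions that may be inserted into the sources. Besides the solutions this includes the zero
  function, from which the iteration starts.\<close>
definition admissible :: "'n field \<Rightarrow> bool" where
  "admissible v \<longleftrightarrow> continuous_on S v \<and> (\<forall>X\<in>S. 0 \<le> v X \<and> v X \<le> B)"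

definition source1 :: "real \<Rightarrow> real \<Rightarrow> 'n field \<Rightarrow> 'n field" where
  "source1 \<delta> \<tau> v = padded \<delta> \<tau> (\<lambda>X. f1 X * k1 (v X))"

definition source2 :: "real \<Rightarrow> real \<Rightarrow> 'n field \<Rightarrow> 'n field" where
  "source2 \<delta> \<tau> u = padded \<delta> \<tau> (\<lambda>X. f2 X * k2 (u X))"

lemma admissible1: "u \<in> E1.W \<Longrightarrow> admissible u"
  unfolding admissible_def using E1.W_continuous E1.W_nonneg E1.W_up up1 by (meson order_trans)

lemma admissible2: "v \<in> E2.W \<Longrightarrow> admissible v"
  unfolding admissible_def using E2.W_continuous E2.W_nonneg E2.W_up up2 by (meson order_trans)

lemma source1_Linf:
  assumes "admissible v" "0 < \<delta>" "\<delta> \<le> 1" "0 \<le> \<tau>" "\<tau> \<le> 1"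
  shows "source1 \<delta> \<tau> v \<in> Linf_nonneg S" "Linf_norm S (source1 \<delta> \<tau> v) = M"
    "0 < \<tau> \<Longrightarrow> X \<in> S \<Longrightarrow> 0 < source1 \<delta> \<tau> v X"
proof -
  have v: "continuous_on S v" "\<And>X. X \<in> S \<Longrightarrow> v X \<le> B"
    using assms(1) unfolding admissible_def by auto
  have G: "(\<lambda>X. f1 X * k1 (v X)) \<in> Linf_nonneg S"
    "AE X in lebesgue_on S. \<bar>f1 X * k1 (v X)\<bar> \<le> Linf_norm S f1 * k1 B"
    by (rule E1.coupled_source_Linf[OF f1 k1 v]; assumption)+
  have "AE X in lebesgue_on S. \<bar>f1 X * k1 (v X)\<bar> \<le> M - 1"
    using G(2) by (rule eventually_mono) (rule order_trans[OF _ M1])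
  note * = E1.padded_Linf[OF G(1) this E1.M_ge_1 assms(2-5), folded source1_def]
  show "source1 \<delta> \<tau> v \<in> Linf_nonneg S" "Linf_norm S (source1 \<delta> \<tau> v) = M"
    "0 < \<tau> \<Longrightarrow> X \<in> S \<Longrightarrow> 0 < source1 \<delta> \<tau> v X"
    by (rule *; assumption)+
qed

lemma source2_Linf:
  assumes "admissible u" "0 < \<delta>" "\<delta> \<le> 1" "0 \<le> \<tau>" "\<tau> \<le> 1"
  shows "source2 \<delta> \<tau> u \<in> Linf_nonneg S" "Linf_norm S (source2 \<delta> \<tau> u) = M"
    "0 < \<tau> \<Longrightarrow> X \<in> S \<Longrightarrow> 0 < source2 \<delta> \<tau> u X"
proof -
  have u: "continuous_on S u" "\<And>X. X \<in> S \<Longrightarrow> u X \<le> B"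
    using assms(1) unfolding admissible_def by auto
  have G: "(\<lambda>X. f2 X * k2 (u X)) \<in> Linf_nonneg S"
    "AE X in lebesgue_on S. \<bar>f2 X * k2 (u X)\<bar> \<le> Linf_norm S f2 * k2 B"
    by (rule E1.coupled_source_Linf[OF f2 k2 u]; assumption)+
  have "AE X in lebesgue_on S. \<bar>f2 X * k2 (u X)\<bar> \<le> M - 1"
    using G(2) by (rule eventually_mono) (rule order_trans[OF _ M2])
  note * = E1.padded_Linf[OF G(1) this E1.M_ge_1 assms(2-5), folded source2_def]
  show "source2 \<delta> \<tau> u \<in> Linf_nonneg S" "Linf_norm S (source2 \<delta> \<tau> u) = M"
    "0 < \<tau> \<Longrightarrow> X \<in> S \<Longrightarrow> 0 < source2 \<delta> \<tau> u X"
    by (rule *; assumption)+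
qed

lemma source1_strict_mono:
  assumes "\<tau> < \<tau>'" "0 < \<delta>" "X \<in> S" "v X \<le> v' X"
  shows "source1 \<delta> \<tau> v X < source1 \<delta> \<tau>' v' X"
  unfolding source1_def
  using assms f1 k1 by (intro E1.padded_strict_mono mult_left_mono) (auto simp: class_K_def Linf_nonneg_def monoD)

lemma source2_strict_mono:
  assumes "\<tau> < \<tau>'" "0 < \<delta>" "X \<in> S" "u X \<le> u' X"
  shows "source2 \<delta> \<tau> u X < source2 \<delta> \<tau>' u' X"
  unfolding source2_def
  using assms f2 k2 by (intro E1.padded_strict_mono mult_left_mono) (auto simp: class_K_def Linf_nonneg_def monoD)

lemma coupled_limit1:
  assumes "\<And>j::nat. vs j \<in> E2.W" "\<And>X. X \<in> S \<Longrightarrow> (\<lambda>j. vs j X) \<longlonglongrightarrow> v X"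
  shows "Linf_loc_limit S (\<lambda>j X. f1 X * k1 (vs j X)) (\<lambda>X. f1 X * k1 (v X))"
  using admissible2[OF assms(1)] admissible2[OF E2.W_closed[OF assms]] unfolding admissible_def
  by (intro E1.coupled_source_limit[OF f1 k1 E2.W_locally_uniform[OF assms]]) auto

lemma coupled_limit2:
  assumes "\<And>j::nat. us j \<in> E1.W" "\<And>X. X \<in> S \<Longrightarrow> (\<lambda>j. us j X) \<longlonglongrightarrow> u X"
  shows "Linf_loc_limit S (\<lambda>j X. f2 X * k2 (us j X)) (\<lambda>X. f2 X * k2 (u X))"
  using admissible1[OF assms(1)] admissible1[OF E1.W_closed[OF assms]] unfolding admissible_def
  by (intro E1.coupled_source_limit[OF f2 k2 E1.W_locally_uniform[OF assms]]) auto

text \<open>The monotone iteration. The \<open>u\<close>'s decrease because their sources increase, and the \<open>v\<close>'s increase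
  because their sources decrease; accordingly the parameter of the first source increases to \<open>1\<close> and
  that of the second one decreases to \<open>0\<close>, the values seen in the limit equations.\<close>
lemma regularized_solution:
  assumes h1: "h1 \<in> class_H_tilde a1 C01" and h2: "h2 \<in> class_H_tilde a2 C02"
    and \<delta>: "0 < \<delta>" "\<delta> \<le> 1"
  obtains u v where "u \<in> \<F>1" "u \<in> E1.W" "v \<in> \<F>2" "v \<in> E2.W"
    "sol1 L1 (S \<inter> {X. 0 < u X}) u (\<lambda>X. source1 \<delta> 1 v X * h1 (u X))"
    "sol2 L2 (S \<inter> {X. 0 < v X}) v (\<lambda>X. source2 \<delta> 0 u X * h2 (v X))"
proof -
  define A1 where "A1 \<tau> v = (SOME w. w \<in> \<F>1 \<and> w \<in> E1.W \<and> sol1 L1 S w (\<lambda>X. source1 \<delta> \<tau> v X * h1 (w X)))" for \<tau> v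
  define A2 where "A2 \<tau> u = (SOME w. w \<in> \<F>2 \<and> w \<in> E2.W \<and> sol2 L2 S w (\<lambda>X. source2 \<delta> \<tau> u X * h2 (w X)))" for \<tau> u
  have A1: "A1 \<tau> v \<in> \<F>1 \<and> A1 \<tau> v \<in> E1.W \<and> sol1 L1 S (A1 \<tau> v) (\<lambda>X. source1 \<delta> \<tau> v X * h1 (A1 \<tau> v X))"
    if "admissible v" "0 < \<tau>" "\<tau> < 1" for \<tau> v
  proof -
    have "\<exists>w\<in>\<F>1. w \<in> E1.W \<and> sol1 L1 S w (\<lambda>X. source1 \<delta> \<tau> v X * h1 (w X))"
      by (rule E1.solve[OF _ _ _ h1]) (use source1_Linf[OF that(1) \<delta>] that in auto)
    then have "\<exists>w. w \<in> \<F>1 \<and> w \<in> E1.W \<and> sol1 L1 S w (\<lambda>X. source1 \<delta> \<tau> v X * h1 (w X))"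
      by blast
    then show ?thesis unfolding A1_def by (rule someI_ex)
  qed
  have A2: "A2 \<tau> u \<in> \<F>2 \<and> A2 \<tau> u \<in> E2.W \<and> sol2 L2 S (A2 \<tau> u) (\<lambda>X. source2 \<delta> \<tau> u X * h2 (A2 \<tau> u X))"
    if "admissible u" "0 < \<tau>" "\<tau> < 1" for \<tau> u
  proof -
    have "\<exists>w\<in>\<F>2. w \<in> E2.W \<and> sol2 L2 S w (\<lambda>X. source2 \<delta> \<tau> u X * h2 (w X))"
      by (rule E2.solve[OF _ _ _ h2]) (use source2_Linf[OF that(1) \<delta>] that in auto)
    then have "\<exists>w. w \<in> \<F>2 \<and> w \<in> E2.W \<and> sol2 L2 S w (\<lambda>X. source2 \<delta> \<tau> u X * h2 (w X))"
      by blast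
    then show ?thesis unfolding A2_def by (rule someI_ex)
  qed
  have mono1: "A1 \<tau>' v' X \<le> A1 \<tau> v X"
    if hyp: "admissible v" "admissible v'" "0 < \<tau>" "\<tau> < \<tau>'" "\<tau>' < 1" "\<And>X. X \<in> S \<Longrightarrow> v X \<le> v' X" "X \<in> S"
    for \<tau> \<tau>' v v' X
  proof -
    have \<tau>: "\<tau> < 1" "0 < \<tau>'" using hyp by auto
    note w = A1[OF hyp(1,3) \<tau>(1)] and w' = A1[OF hyp(2) \<tau>(2) hyp(5)]
    have "source1 \<delta> \<tau> v \<in> Linf_nonneg S" "source1 \<delta> \<tau>' v' \<in> Linf_nonneg S"
      using hyp \<tau> \<delta> by (auto intro!: source1_Linf(1))
    moreover have "source1 \<delta> \<tau> v X < source1 \<delta> \<tau>' v' X" if "X \<in> S" for X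
      by (rule source1_strict_mono[where v=v and v'=v', OF hyp(4) \<delta>(1) that hyp(6)[OF that]])
    ultimately show ?thesis
      using w w' E1.W_boundary_values \<open>X \<in> S\<close>
      by (intro E1.compare[OF _ _ h1, where f="source1 \<delta> \<tau> v" and f'="source1 \<delta> \<tau>' v'"]) simp_all
  qed
  have mono2: "A2 \<tau>' u' X \<le> A2 \<tau> u X"
    if hyp: "admissible u" "admissible u'" "0 < \<tau>" "\<tau> < \<tau>'" "\<tau>' < 1" "\<And>X. X \<in> S \<Longrightarrow> u X \<le> u' X" "X \<in> S"
    for \<tau> \<tau>' u u' X
  proof -
    have \<tau>: "\<tau> < 1" "0 < \<tau>'" using hyp by auto
    note w = A2[OF hyp(1,3) \<tau>(1)] and w' = A2[OF hyp(2) \<tau>(2) hyp(5)]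
    have "source2 \<delta> \<tau> u \<in> Linf_nonneg S" "source2 \<delta> \<tau>' u' \<in> Linf_nonneg S"
      using hyp \<tau> \<delta> by (auto intro!: source2_Linf(1))
    moreover have "source2 \<delta> \<tau> u X < source2 \<delta> \<tau>' u' X" if "X \<in> S" for X
      by (rule source2_strict_mono[where u=u and u'=u', OF hyp(4) \<delta>(1) that hyp(6)[OF that]])
    ultimately show ?thesis
      using w w' E2.W_boundary_values \<open>X \<in> S\<close>
      by (intro E2.compare[OF _ _ h2, where f="source2 \<delta> \<tau> u" and f'="source2 \<delta> \<tau>' u'"]) simp_all
  qed
  \<comment> \<open>The parameters stay strictly between \<open>0\<close> and \<open>1\<close>, so that all sources are positive.\<close>
  define \<sigma> :: "nat \<Rightarrow> real" where "\<sigma> m = 1 / real (m + 2)" for m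
  have \<sigma>: "0 < \<sigma> m" "\<sigma> m < 1" "\<sigma> (Suc m) < \<sigma> m" for m
    by (auto simp: \<sigma>_def frac_less2)
  have \<sigma>_lim: "\<sigma> \<longlonglongrightarrow> 0"
    unfolding \<sigma>_def using LIMSEQ_ignore_initial_segment[OF lim_1_over_n, of 2] by simp
  define u where "u = rec_nat (A1 (1 - \<sigma> 0) (\<lambda>_. 0)) (\<lambda>m um. A1 (1 - \<sigma> (Suc m)) (A2 (\<sigma> m) um))"
  define v where "v m = A2 (\<sigma> m) (u m)" for m
  have u_0: "u 0 = A1 (1 - \<sigma> 0) (\<lambda>_. 0)" and u_Suc: "u (Suc m) = A1 (1 - \<sigma> (Suc m)) (v m)" for m
    by (simp_all add: u_def v_def)
  have zero: "admissible (\<lambda>_. 0)" unfolding admissible_def using B by simp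
  have uv: "u m \<in> E1.W \<and> v m \<in> E2.W" for m
  proof (induction m)
    case 0
    have "u 0 \<in> E1.W" unfolding u_0 using A1[OF zero] \<sigma> by simp
    then show ?case unfolding v_def using A2[OF admissible1] \<sigma> by simp
  next
    case (Suc m)
    then have "u (Suc m) \<in> E1.W" unfolding u_Suc using A1[OF admissible2] \<sigma> by simp
    then show ?case unfolding v_def using A2[OF admissible1] \<sigma> by simp
  qed
  then have adm: "admissible (u m)" "admissible (v m)" for m
    using admissible1 admissible2 by auto
  have v_step: "v m X \<le> v (Suc m) X" if "\<And>X. X \<in> S \<Longrightarrow> u (Suc m) X \<le> u m X" "X \<in> S" for m X
    unfolding v_def using that \<sigma> adm by (intro mono2) auto
  \<comment> \<open>The induction starts because \<open>u 0\<close> was solved with the zero function in place of \<open>v\<close>.\<close>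
  have u_step: "\<forall>X\<in>S. u (Suc m) X \<le> u m X" for m
  proof (induction m)
    case 0
    show ?case unfolding u_Suc unfolding u_0
      using \<sigma> adm zero by (intro ballI mono1) (auto simp: admissible_def)
  next
    case (Suc m)
    show ?case unfolding u_Suc[of "Suc m"] unfolding u_Suc[of m]
      using \<sigma> adm v_step Suc by (intro ballI mono1) auto
  qed
  have "\<exists>l. (\<lambda>m. u m X) \<longlonglongrightarrow> l" if X: "X \<in> S" for X
  proof -
    have "decseq (\<lambda>m. u m X)" using u_step X by (auto simp: decseq_Suc_iff)
    moreover have "\<forall>m. 0 \<le> u m X" using adm X by (auto simp: admissible_def)
    ultimately show ?thesis using decseq_convergent by metis
  qed
  then obtain u' where u': "\<And>X. X \<in> S \<Longrightarrow> (\<lambda>m. u m X) \<longlonglongrightarrow> u' X" by metis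
  have "\<exists>l. (\<lambda>m. v m X) \<longlonglongrightarrow> l" if X: "X \<in> S" for X
  proof -
    have "incseq (\<lambda>m. v m X)" using v_step u_step X by (auto simp: incseq_Suc_iff)
    moreover have "\<forall>m. v m X \<le> B" using adm X by (auto simp: admissible_def)
    ultimately show ?thesis using incseq_convergent by metis
  qed
  then obtain v' where v': "\<And>X. X \<in> S \<Longrightarrow> (\<lambda>m. v m X) \<longlonglongrightarrow> v' X" by metis
  have const: "locally_uniform_limit A (\<lambda>_. h) h" for A and h :: "real \<Rightarrow> real"
    unfolding locally_uniform_limit_def uniform_limit_iff by simp
  have u'W: "u' \<in> E1.W" and v'W: "v' \<in> E2.W"
    using E1.W_closed[OF _ u'] E2.W_closed[OF _ v'] uv by auto
  have u'_Suc: "(\<lambda>m. u (Suc m) X) \<longlonglongrightarrow> u' X" if "X \<in> S" for X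
    using u'[OF that] by (rule LIMSEQ_Suc)
  have lim1: "Linf_loc_limit S (\<lambda>m. source1 \<delta> (1 - \<sigma> (Suc m)) (v m)) (source1 \<delta> 1 v')"
    unfolding source1_def
  proof (rule E1.padded_limit_parameter[OF coupled_limit1[OF _ v'] _ \<delta>(1)])
    show "(\<lambda>m. 1 - \<sigma> (Suc m)) \<longlonglongrightarrow> 1"
      using tendsto_diff[OF tendsto_const LIMSEQ_Suc[OF \<sigma>_lim], of 1] by simp
  qed (use uv in auto)
  have lim2: "Linf_loc_limit S (\<lambda>m. source2 \<delta> (\<sigma> m) (u m)) (source2 \<delta> 0 u')"
    unfolding source2_def
    by (rule E1.padded_limit_parameter[OF coupled_limit2[OF _ u'] \<sigma>_lim \<delta>(1)]) (use uv in auto)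
  have P1: "u (Suc m) \<in> \<F>1" "sol1 L1 S (u (Suc m)) (\<lambda>X. source1 \<delta> (1 - \<sigma> (Suc m)) (v m) X * h1 (u (Suc m) X))" for m
    unfolding u_Suc using A1[OF adm(2)[of m], of "1 - \<sigma> (Suc m)"] \<sigma>[of "Suc m"] by auto
  have P2: "v m \<in> \<F>2" "sol2 L2 S (v m) (\<lambda>X. source2 \<delta> (\<sigma> m) (u m) X * h2 (v m X))" for m
    unfolding v_def using A2[OF adm(1)[of m], of "\<sigma> m"] \<sigma>[of m] by auto
  have R1: "source1 \<delta> (1 - \<sigma> m) w \<in> Linf_nonneg S" "Linf_norm S (source1 \<delta> (1 - \<sigma> m) w) = M"
    if "admissible w" for m w
    by (rule source1_Linf; use that \<delta> \<sigma>[of m] in simp)+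
  have R2: "source2 \<delta> (\<sigma> m) w \<in> Linf_nonneg S" "Linf_norm S (source2 \<delta> (\<sigma> m) w) = M"
    if "admissible w" for m w
    by (rule source2_Linf; use that \<delta> \<sigma>[of m] in simp)+
  have S1: "source1 \<delta> 1 v' \<in> Linf S" and S2: "source2 \<delta> 0 u' \<in> Linf S"
    using source1_Linf(1)[OF admissible2[OF v'W] \<delta>, of 1] source2_Linf(1)[OF admissible1[OF u'W] \<delta>, of 0]
    by (auto simp: Linf_nonneg_def)
  have "u' \<in> \<F>1 \<and> sol1 L1 (S \<inter> {X. 0 < u' X}) u' (\<lambda>X. source1 \<delta> 1 v' X * h1 (u' X))"
    by (rule E1.limit_solution[OF P1(1) _ u'_Suc h1 R1[OF adm(2)] E1.sol_on_positivity_set[OF P1] S1 lim1 _ const])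
      (use uv h1 in auto)
  moreover have "v' \<in> \<F>2 \<and> sol2 L2 (S \<inter> {X. 0 < v' X}) v' (\<lambda>X. source2 \<delta> 0 u' X * h2 (v' X))"
    by (rule E2.limit_solution[OF P2(1) _ v' h2 R2[OF adm(1)] E2.sol_on_positivity_set[OF P2] S2 lim2 _ const])
      (use uv h2 in auto)
  ultimately show thesis using that u'W v'W by blast
qed

text \<open>The layers shrink while the Lipschitz nonlinearities approach \<open>h1\<close> and \<open>h2\<close>. Comparison does not order
  solutions for different nonlinearities, so here the convergence comes from compactness; both
  components of a solution carry the same index, hence a common subsequence is enough.\<close>
lemma coupled_solution:
  assumes h1: "h1 \<in> class_H M0" "\<And>j. hs1 j \<in> class_H_tilde a1 C01" "locally_uniform_limit {0<..} hs1 h1"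
    and h2: "h2 \<in> class_H M0" "\<And>j. hs2 j \<in> class_H_tilde a2 C02" "locally_uniform_limit {0<..} hs2 h2"
  obtains u v where "u \<in> \<F>1" "u \<in> E1.W" "v \<in> \<F>2" "v \<in> E2.W"
    "sol1 L1 (S \<inter> {X. 0 < u X}) u (\<lambda>X. f1 X * k1 (v X) * h1 (u X))"
    "sol2 L2 (S \<inter> {X. 0 < v X}) v (\<lambda>X. f2 X * k2 (u X) * h2 (v X))"
proof -
  define \<delta> :: "nat \<Rightarrow> real" where "\<delta> j = inverse (real (Suc j))" for j
  have \<delta>: "0 < \<delta> j" "\<delta> j \<le> 1" for j by (auto simp: \<delta>_def inverse_le_1_iff)
  define P where "P j u v \<longleftrightarrow> u \<in> \<F>1 \<and> u \<in> E1.W \<and> v \<in> \<F>2 \<and> v \<in> E2.W \<and>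
    sol1 L1 (S \<inter> {X. 0 < u X}) u (\<lambda>X. source1 (\<delta> j) 1 v X * hs1 j (u X)) \<and>
    sol2 L2 (S \<inter> {X. 0 < v X}) v (\<lambda>X. source2 (\<delta> j) 0 u X * hs2 j (v X))" for j u v
  have "\<exists>u v. P j u v" for j
    by (rule regularized_solution[OF h1(2)[of j] h2(2)[of j] \<delta>[of j]]) (unfold P_def, intro exI conjI)
  then obtain u v where P: "\<And>j. P j (u j) (v j)" by metis
  have uv: "\<And>j. u j \<in> \<F>1" "\<And>j. u j \<in> E1.W" "\<And>j. v j \<in> \<F>2" "\<And>j. v j \<in> E2.W"
    "\<And>j. sol1 L1 (S \<inter> {X. 0 < u j X}) (u j) (\<lambda>X. source1 (\<delta> j) 1 (v j) X * hs1 j (u j X))"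
    "\<And>j. sol2 L2 (S \<inter> {X. 0 < v j X}) (v j) (\<lambda>X. source2 (\<delta> j) 0 (u j) X * hs2 j (v j X))"
    using P[unfolded P_def] by simp_all
  obtain r1 u' where r1: "strict_mono r1" "u' \<in> E1.W" "\<And>X. X \<in> S \<Longrightarrow> (\<lambda>j. u (r1 j) X) \<longlonglongrightarrow> u' X"
    by (rule E1.W_convergent_subsequence[of u, OF uv(2) E1.bounded_up]) (rule that; assumption)
  obtain r2 v' where r2: "strict_mono r2" "v' \<in> E2.W" "\<And>X. X \<in> S \<Longrightarrow> (\<lambda>j. v (r1 (r2 j)) X) \<longlonglongrightarrow> v' X"
    by (rule E2.W_convergent_subsequence[of "\<lambda>j. v (r1 j)", OF uv(4) E2.bounded_up]) (rule that; assumption)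
  define r where "r = r1 \<circ> r2"
  have r: "strict_mono r" unfolding r_def using r1(1) r2(1) by (rule strict_mono_o)
  have ulim: "(\<lambda>j. u (r j) X) \<longlonglongrightarrow> u' X" and vlim: "(\<lambda>j. v (r j) X) \<longlonglongrightarrow> v' X" if "X \<in> S" for X
    using LIMSEQ_subseq_LIMSEQ[OF r1(3)[OF that] r2(1)] r2(3)[OF that] by (simp_all add: r_def o_def)
  have \<delta>lim: "(\<lambda>j. \<delta> (r j)) \<longlonglongrightarrow> 0"
    using LIMSEQ_subseq_LIMSEQ[OF LIMSEQ_inverse_real_of_nat r] by (simp add: \<delta>_def o_def)
  have lim1: "Linf_loc_limit S (\<lambda>j. source1 (\<delta> (r j)) 1 (v (r j))) (\<lambda>X. f1 X * k1 (v' X))"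
    unfolding source1_def by (intro E1.padded_limit_layer coupled_limit1 uv vlim \<delta>lim)
  have lim2: "Linf_loc_limit S (\<lambda>j. source2 (\<delta> (r j)) 0 (u (r j))) (\<lambda>X. f2 X * k2 (u' X))"
    unfolding source2_def by (intro E1.padded_limit_layer coupled_limit2 uv ulim \<delta>lim)
  have R1: "source1 (\<delta> j) 1 (v j) \<in> Linf_nonneg S" "Linf_norm S (source1 (\<delta> j) 1 (v j)) = M" for j
    by (rule source1_Linf; use \<delta> admissible2[OF uv(4)] in simp)+
  have R2: "source2 (\<delta> j) 0 (u j) \<in> Linf_nonneg S" "Linf_norm S (source2 (\<delta> j) 0 (u j)) = M" for j
    by (rule source2_Linf; use \<delta> admissible1[OF uv(2)] in simp)+
  have S1: "(\<lambda>X. f1 X * k1 (v' X)) \<in> Linf S" and S2: "(\<lambda>X. f2 X * k2 (u' X)) \<in> Linf S"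
    using E1.coupled_source_Linf(1)[OF f1 k1, of v' B] E1.coupled_source_Linf(1)[OF f2 k2, of u' B]
      admissible2[OF r2(2)] admissible1[OF r1(2)]
    by (auto simp: Linf_nonneg_def admissible_def)
  have "u' \<in> \<F>1 \<and> sol1 L1 (S \<inter> {X. 0 < u' X}) u' (\<lambda>X. f1 X * k1 (v' X) * h1 (u' X))"
    by (rule E1.limit_solution[OF uv(1,2) ulim h1(2) R1 uv(5) S1 lim1 _ locally_uniform_subsequence[OF h1(3) r]])
      (use h1 in auto)
  moreover have "v' \<in> \<F>2 \<and> sol2 L2 (S \<inter> {X. 0 < v' X}) v' (\<lambda>X. f2 X * k2 (u' X) * h2 (v' X))"
    by (rule E2.limit_solution[OF uv(3,4) vlim h2(2) R2 uv(6) S2 lim2 _ locally_uniform_subsequence[OF h2(3) r]])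
      (use h2 in auto)
  ultimately show thesis using that r1(2) r2(2) by blast
qed

end

theorem theorem7:
  fixes \<Omega> :: "(real ^ 'n) set"
    and T M0 c C a1 a2 C01 C02 :: real
    and g1 g2 f1 f2 :: "'n field"
    and h1 h2 k1 k2 :: "real \<Rightarrow> real"
    and sol1 sol2 :: "'n solution_notion"
    and L1 L2 :: "'n operator"
    and \<F>1 \<F>2 :: "'n field set"
  assumes "bounded_domain \<Omega>" and "0 < T" and "0 < M0"
    and "0 < c" and "c < C"
    and "g1 \<in> cont_nonneg (parabolic_boundary \<Omega> T)" and "g2 \<in> cont_nonneg (parabolic_boundary \<Omega> T)"
    and "\<forall>Y\<in>parabolic_boundary \<Omega> T. c < g1 Y \<and> g1 Y < C"
    and "\<forall>Y\<in>parabolic_boundary \<Omega> T. c < g2 Y \<and> g2 Y < C"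
    and "sup_norm (parabolic_boundary \<Omega> T) g1 \<le> M0" and "sup_norm (parabolic_boundary \<Omega> T) g2 \<le> M0"
    and "f1 \<in> Linf_nonneg (cylinder \<Omega> T)" and "f2 \<in> Linf_nonneg (cylinder \<Omega> T)"
    and "-1 < a1" and "a1 < 1" and "0 < C01" and "h1 \<in> class_H_const M0 a1 C01"
    and "-1 < a2" and "a2 < 1" and "0 < C02" and "h2 \<in> class_H_const M0 a2 C02"
    and "k1 \<in> class_K" and "k2 \<in> class_K"
    and "operator_on \<Omega> T sol1 L1 \<F>1" and "operator_on \<Omega> T sol2 L2 \<F>2"
    and "solvability \<Omega> T a1 C01 sol1 L1 \<F>1" and "solvability \<Omega> T a2 C02 sol2 L2 \<F>2"
    and "comparison \<Omega> T a1 C01 sol1 L1 \<F>1" and "comparison \<Omega> T a2 C02 sol2 L2 \<F>2"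
    and "convergence \<Omega> T M0 a1 C01 sol1 L1 \<F>1" and "convergence \<Omega> T M0 a2 C02 sol2 L2 \<F>2"
  shows "\<exists>u\<in>\<F>1. \<exists>v\<in>\<F>2.
    sol1 L1 (cylinder \<Omega> T \<inter> {X. 0 < u X}) u (\<lambda>X. f1 X * k1 (v X) * h1 (u X)) \<and>
    sol2 L2 (cylinder \<Omega> T \<inter> {X. 0 < v X}) v (\<lambda>X. f2 X * k2 (u X) * h2 (v X)) \<and>
    boundary_values \<Omega> T u g1 \<and> boundary_values \<Omega> T v g2 \<and>
    free_boundary_condition \<Omega> T u \<and> free_boundary_condition \<Omega> T v"
proof -
  interpret space_time_cylinder \<Omega> T
    using assms(1,2) by unfold_locales
  interpret E1: singular_equation \<Omega> T sol1 L1 \<F>1 a1 C01 M0 g1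
    using assms(6,24,26,28,30) by unfold_locales
  interpret E2: singular_equation \<Omega> T sol2 L2 \<F>2 a2 C02 M0 g2
    using assms(7,25,27,29,31) by unfold_locales
  obtain N1 where N1: "1 \<le> N1" "(\<lambda>t. h1 t / N1) \<in> class_H_const M0 a1 C01"
      "\<And>t. 0 < t \<Longrightarrow> h1 t / N1 \<le> C01 * t powr a1 + 1"
    by (rule class_H_rescale[OF assms(17,16)]) (rule that; assumption)
  obtain N2 where N2: "1 \<le> N2" "(\<lambda>t. h2 t / N2) \<in> class_H_const M0 a2 C02"
      "\<And>t. 0 < t \<Longrightarrow> h2 t / N2 \<le> C02 * t powr a2 + 1"
    by (rule class_H_rescale[OF assms(21,20)]) (rule that; assumption)
  have H1: "(\<lambda>t. h1 t / N1) \<in> class_H M0" and H2: "(\<lambda>t. h2 t / N2) \<in> class_H M0"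
    unfolding class_H_def using N1(2) N2(2) assms(14-16,18-20) by blast+
  obtain hs1 where hs1: "\<And>j::nat. hs1 j \<in> class_H_tilde a1 C01"
      "locally_uniform_limit {0<..} hs1 (\<lambda>t. h1 t / N1)"
    by (rule lipschitz_approximation[OF N1(2)]) (erule N1(3), (rule that; assumption))
  obtain hs2 where hs2: "\<And>j::nat. hs2 j \<in> class_H_tilde a2 C02"
      "locally_uniform_limit {0<..} hs2 (\<lambda>t. h2 t / N2)"
    by (rule lipschitz_approximation[OF N2(2)]) (erule N2(3), (rule that; assumption))
  define F1 where "F1 X = N1 * f1 X" for X
  define F2 where "F2 X = N2 * f2 X" for X
  have F: "F1 \<in> Linf_nonneg S" "F2 \<in> Linf_nonneg S"
    unfolding F1_def F2_def using assms(12,13) N1(1) N2(1) by (auto intro: Linf_nonneg_scale)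
  obtain U where U: "E1.upper_barrier U" using E1.ex_upper_barrier[OF hs1(1)] by blast
  obtain V where V: "E2.upper_barrier V" using E2.ex_upper_barrier[OF hs2(1)] by blast
  have "bounded (U ` S)" "bounded (V ` S)"
    using U V unfolding E1.upper_barrier_def E2.upper_barrier_def by blast+
  note bdd = this[unfolded bounded_real]
  obtain b1 where b1: "\<And>X. X \<in> S \<Longrightarrow> \<bar>U X\<bar> \<le> b1" using bdd(1) by auto
  obtain b2 where b2: "\<And>X. X \<in> S \<Longrightarrow> \<bar>V X\<bar> \<le> b2" using bdd(2) by auto
  \<comment> \<open>Neither barrier depends on \<open>M\<close>, so \<open>M\<close> may be chosen after the bound \<open>B\<close> that they provide.\<close>
  define B where "B = \<bar>b1\<bar> + \<bar>b2\<bar>"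
  define M where "M = 1 + \<bar>Linf_norm S F1 * k1 B\<bar> + \<bar>Linf_norm S F2 * k2 B\<bar>"
  have M: "1 \<le> M" by (simp add: M_def)
  obtain \<rho>1 K1 \<alpha>1 lo1 where E1': "controlled_equation \<Omega> T sol1 L1 \<F>1 a1 C01 M0 g1 \<rho>1 K1 \<alpha>1 lo1 U M"
    by (rule E1.controlled_equation[OF hs1(1) M U]) (rule that; assumption)
  obtain \<rho>2 K2 \<alpha>2 lo2 where E2': "controlled_equation \<Omega> T sol2 L2 \<F>2 a2 C02 M0 g2 \<rho>2 K2 \<alpha>2 lo2 V M"
    by (rule E2.controlled_equation[OF hs2(1) M V]) (rule that; assumption)
  have "coupled_system_axioms \<Omega> T M U V F1 F2 k1 k2 B"
  proof
    show "U X \<le> B" "V X \<le> B" if "X \<in> S" for X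
      using b1[OF that] b2[OF that] by (auto simp: B_def)
    show "Linf_norm S F1 * k1 B \<le> M - 1" "Linf_norm S F2 * k2 B \<le> M - 1"
      by (auto simp: M_def)
  qed (use F assms(22,23) in \<open>auto simp: B_def\<close>)
  with E1' E2' interpret sys: coupled_system \<Omega> T M0 M sol1 L1 \<F>1 a1 C01 g1 \<rho>1 K1 \<alpha>1 lo1 U
      sol2 L2 \<F>2 a2 C02 g2 \<rho>2 K2 \<alpha>2 lo2 V F1 F2 k1 k2 B
    by (rule coupled_system.intro)
  obtain u v where uv: "u \<in> \<F>1" "u \<in> sys.E1.W" "v \<in> \<F>2" "v \<in> sys.E2.W"
    and sol: "sol1 L1 (S \<inter> {X. 0 < u X}) u (\<lambda>X. F1 X * k1 (v X) * (h1 (u X) / N1))"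
      "sol2 L2 (S \<inter> {X. 0 < v X}) v (\<lambda>X. F2 X * k2 (u X) * (h2 (v X) / N2))"
    by (rule sys.coupled_solution[OF H1 hs1 H2 hs2]) (rule that; assumption)
  have "(\<lambda>X. F1 X * k1 (v X) * (h1 (u X) / N1)) = (\<lambda>X. f1 X * k1 (v X) * h1 (u X))"
    "(\<lambda>X. F2 X * k2 (u X) * (h2 (v X) / N2)) = (\<lambda>X. f2 X * k2 (u X) * h2 (v X))"
    using N1(1) N2(1) by (auto simp: F1_def F2_def)
  note sol' = sol[unfolded this]
  show ?thesis
    using sol' sys.E1.W_boundary_values[OF uv(2)] sys.E2.W_boundary_values[OF uv(4)]
      sys.E1.W_free_boundary_condition[OF uv(2)] sys.E2.W_free_boundary_condition[OF uv(4)]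
    by (intro bexI[of _ u] bexI[of _ v] conjI uv(1,3))
qed

end
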